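(* Let $u:\mathbb{R}^d\to\mathbb{R}$ satisfy $u\le 0$ in $\mathbb{R}^d\setminus B_1$, let $\Gamma$ be the concave envelope of $u$ in $B_3$, and assume that $\mathcal{M}_i^+u(x)\ge -f(x)$ in $B_1$ (in the viscosity sense) for some $i\ge 0$ and some function $f$. Let $\Sigma=\{u=\Gamma\}\cap B_1$ be the contact set and $\rho_0=\frac{1}{16\sqrt d}$. Then there is a finite family of open cubes $Q_1,\dots,Q_m$, with diameters $d_1,\dots,d_m$, such that the following hold: (i) any two distinct cubes $Q_j$ and $Q_l$ in the family do not intersect; (ii) $\Sigma\subset\bigcup_{j=1}^m\overline{Q}_j$; (iii) $\Sigma\cap\overline{Q}_j\ne\emptyset$ for any $Q_j$; (iv) $d_j\le\rho_0\,2^{-1/(2-\alpha)}$; (v) $|\nabla\Gamma(\overline{Q}_j)|\le C\,\bigl(\max_{\overline{Q}_j}f(x)\bigr)^d\,|\overline{Q}_j|$; (vi) $\bigl|\{y\in 8\sqrt d\,Q_j:\ u(y)>\Gamma(y)-C\,(\max_{\overline{Q}_j}f(x))\,d_j^2\}\bigr|\ge\mu\,|Q_j|$. The constants $C>0$ and $\mu>0$ depend only on $(\lambda,d,\rho_0)$, but not on $i$ and $\alpha$.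
   Context: Setting. $d$ is the dimension, $0<\lambda\le\Lambda$ are constants, $\beta\in(0,2)$, $\alpha\in(\beta,2)$. The function $\varphi:(0,\infty)\to(0,\infty)$ is locally bounded and satisfies, for some constant $\kappa_\circ>0$, $\varphi(st)\le\kappa_\circ s^\beta\varphi(t)$ for all $s\ge1$, $t>0$, and $\int_0^1\frac{\varphi(y)}{y}\,dy<\infty$. Operators. $\delta(u,x,y)=u(x+y)+u(x-y)-2u(x)$, and $\delta^\pm$ are its positive and negative parts ($\delta=\delta^+-\delta^-$). For $i\ge0$ put $\varphi_i(t)=\frac{\kappa_\circ}{(2^{i})^{\alpha-\beta}}\varphi(t)$ and $$\mathcal{M}_i^+u(x)=\int_{\mathbb{R}^d}\Bigl[\frac{\Lambda\,\delta^+(u,x,y)}{|y|^d}\Bigl(\frac{2-\alpha}{|y|^\alpha}+\varphi_i(1/|y|)\Bigr)-\frac{\lambda\,\delta^-(u,x,y)}{|y|^d}\,\frac{2-\alpha}{|y|^\alpha}\Bigr]dy .$$ Viscosity sense. For an open set $\Omega$, a bounded function $u:\mathbb{R}^d\to\mathbb{R}$, upper semicontinuous in $\overline\Omega$, satisfies $Iu\ge g$ in $\Omega$ in the viscosity sense (viscosity subsolution) if, whenever a $C^2$ function $\psi$ touches $u$ from above at $x\in\Omega$ in a small neighbourhood $N_x\Subset\Omega$ (i.e. $\psi\ge u$ in $N_x$, $\psi(x)=u(x)$), the function $v$ equal to $\psi$ in $N_x$ and to $u$ elsewhere satisfies $Iv(x)\ge g(x)$. Notation. $B_r$ is the ball of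 radius $r$ centred at $0$; $|\cdot|$ of a set is Lebesgue measure. The concave envelope of $u$ in $B_3$ is $\Gamma(x)=\inf\{p(x): p \text{ is a plane (affine function) satisfying } p\ge u^+\text{ in }B_3\}$ for $x\in B_3$ and $\Gamma=0$ in $\mathbb{R}^d\setminus B_3$. $\nabla\Gamma(x)$ denotes any element of the superdifferential of the concave function $\Gamma|_{B_3}$ at $x$, and $\nabla\Gamma(E)$ the union of the superdifferentials at points of $E$. $8\sqrt d\,Q_j$ is the cube with the same centre as $Q_j$ dilated by the factor $8\sqrt d$.
   Formalization: In (vi) the strict inequality is asserted only for cubes where the maximum of f is nonzero; where it is zero, ">" becomes "≥", since (vi) fails for u = f = 0. The function u is assumed measurable, and the maximum of f is read as a supremum. *)

theory Defs
  imports "HOL-Analysis.Analysis"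
begin

text \<open>The space $R^d$ is a type \<open>'a::euclidean_space\<close> with $d$ = \<open>DIM('a)\<close>.\<close>

section \<open>The operator\<close>

text \<open>Measurability is the only clause not spelled out by the growth conditions: it is what
  makes the integrals below meaningful.\<close>

definition admissible_weight :: "real \<Rightarrow> real \<Rightarrow> (real \<Rightarrow> real) \<Rightarrow> bool" where
  "admissible_weight \<kappa> \<beta> \<phi> \<longleftrightarrow>
     0 < \<kappa> \<and>
     (\<forall>t>0. 0 < \<phi> t) \<and>
     set_borel_measurable lebesgue {0<..} \<phi> \<and>
     (\<forall>K. compact K \<and> K \<subseteq> {0<..} \<longrightarrow> bounded (\<phi> ` K)) \<and>
     (\<forall>s\<ge>1. \<forall>t>0. \<phi> (s * t) \<le> \<kappa> * s powr \<beta> * \<phi> t) \<and>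
     set_integrable lebesgue {0<..<1} (\<lambda>y. \<phi> y / y)"

definition second_diff :: "('a::euclidean_space \<Rightarrow> real) \<Rightarrow> 'a \<Rightarrow> 'a \<Rightarrow> real" where
  "second_diff u x y = u (x + y) + u (x - y) - 2 * u x"

definition weight_scaled ::
  "real \<Rightarrow> real \<Rightarrow> real \<Rightarrow> (real \<Rightarrow> real) \<Rightarrow> nat \<Rightarrow> real \<Rightarrow> real" where
  "weight_scaled \<kappa> \<beta> \<alpha> \<phi> i t = \<kappa> / (2 ^ i) powr (\<alpha> - \<beta>) * \<phi> t"

definition Mplus ::
  "real \<Rightarrow> real \<Rightarrow> real \<Rightarrow> real \<Rightarrow> real \<Rightarrow> (real \<Rightarrow> real) \<Rightarrow> nat \<Rightarrow>
   ('a::euclidean_space \<Rightarrow> real) \<Rightarrow> 'a \<Rightarrow> real" where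
  "Mplus lam Lam \<kappa> \<beta> \<alpha> \<phi> i u x =
     (LINT y|lebesgue.
        Lam * max 0 (second_diff u x y) / norm y ^ DIM('a) *
          ((2 - \<alpha>) / norm y powr \<alpha> + weight_scaled \<kappa> \<beta> \<alpha> \<phi> i (1 / norm y))
        - lam * max 0 (- second_diff u x y) / norm y ^ DIM('a) * ((2 - \<alpha>) / norm y powr \<alpha>))"

section \<open>Viscosity subsolutions\<close>

definition usc_on :: "'a::topological_space set \<Rightarrow> ('a \<Rightarrow> real) \<Rightarrow> bool" where
  "usc_on S u \<longleftrightarrow> (\<forall>x\<in>S. \<forall>a>u x. eventually (\<lambda>y. u y < a) (at x within S))"

definition C2 :: "('a::euclidean_space \<Rightarrow> real) \<Rightarrow> bool" where
  "C2 \<psi> \<longleftrightarrow>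
     (\<exists>(D :: 'a \<Rightarrow> 'a \<Rightarrow>\<^sub>L real) (D2 :: 'a \<Rightarrow> 'a \<Rightarrow>\<^sub>L 'a \<Rightarrow>\<^sub>L real).
        (\<forall>x. (\<psi> has_derivative blinfun_apply (D x)) (at x)) \<and>
        (\<forall>x. (D has_derivative blinfun_apply (D2 x)) (at x)) \<and>
        continuous_on UNIV D2)"

text \<open>Test functions are $C^2$ on the whole space. Allowing \<open>\<psi>\<close> to be $C^2$ only near the
  compact set \<open>closure N\<close> gives the same notion, by cutting off, because only \<open>\<psi>\<close> on \<open>N\<close> enters.
  For measurable \<open>u\<close> and an admissible weight the integral defining \<open>Mplus\<close> converges absolutely at \<open>v\<close> and \<open>x\<close>.\<close>

definition viscosity_subsolution ::
  "(('a::euclidean_space \<Rightarrow> real) \<Rightarrow> 'a \<Rightarrow> real) \<Rightarrow> 'a set \<Rightarrow> ('a \<Rightarrow> real) \<Rightarrow> ('a \<Rightarrow> real) \<Rightarrow> bool"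
  where
  "viscosity_subsolution I \<Omega> g u \<longleftrightarrow>
     open \<Omega> \<and> bounded (range u) \<and> usc_on (closure \<Omega>) u \<and>
     (\<forall>x\<in>\<Omega>. \<forall>N \<psi>.
        open N \<and> x \<in> N \<and> compact (closure N) \<and> closure N \<subseteq> \<Omega> \<and>
        C2 \<psi> \<and> (\<forall>y\<in>N. u y \<le> \<psi> y) \<and> \<psi> x = u x
        \<longrightarrow> g x \<le> I (\<lambda>y. if y \<in> N then \<psi> y else u y) x)"

section \<open>The concave envelope in the ball of radius 3\<close>

definition concave_envelope :: "('a::euclidean_space \<Rightarrow> real) \<Rightarrow> 'a \<Rightarrow> real" where
  "concave_envelope u x =
     (if x \<in> ball 0 3
      then Inf {a + b \<bullet> x | a b. \<forall>y\<in>ball 0 3. max 0 (u y) \<le> a + b \<bullet> y}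
      else 0)"

definition superdifferential ::
  "'a::euclidean_space set \<Rightarrow> ('a \<Rightarrow> real) \<Rightarrow> 'a \<Rightarrow> 'a set" where
  "superdifferential S g x = {b. \<forall>y\<in>S. g y \<le> g x + b \<bullet> (y - x)}"

definition grad_envelope :: "('a::euclidean_space \<Rightarrow> real) \<Rightarrow> 'a set \<Rightarrow> 'a set" where
  "grad_envelope u E = (\<Union>x\<in>E. superdifferential (ball 0 3) (concave_envelope u) x)"

definition contact_set :: "('a::euclidean_space \<Rightarrow> real) \<Rightarrow> 'a set" where
  "contact_set u = {x. u x = concave_envelope u x} \<inter> ball 0 1"

section \<open>Cubes\<close>

definition open_cube :: "'a::euclidean_space \<Rightarrow> real \<Rightarrow> 'a set" where
  "open_cube c s = box (c - (s / 2) *\<^sub>R One) (c + (s / 2) *\<^sub>R One)"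

text \<open>Nothing guarantees that an arbitrary \<open>f\<close> attains its maximum on a closed cube, or is bounded
  above there. The extended supremum agrees with the maximum whenever the latter exists.\<close>

definition sup_over :: "'a set \<Rightarrow> ('a \<Rightarrow> real) \<Rightarrow> ereal" where
  "sup_over E f = (SUP x\<in>E. ereal (f x))"

end

theory Submission
  imports Defs
begin

text \<open>
  At a contact point \<open>x\<close> the equation can be evaluated with a supporting plane \<open>P\<close> of the envelope as
  test function. Since \<open>P - u\<close> is nonnegative in the ball of radius 3 and \<open>u \<le> 0\<close> outside the unit
  ball, all second differences at \<open>x\<close> are nonpositive, so only the \<open>\<lambda>\<close>-part of the operator survives
  and the weighted integral of \<open>P - u\<close> against $(2-\alpha)|y|^{-d-\alpha}$ is at most \<open>f x / \<lambda>\<close>. If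
  \<open>P - u\<close> exceeded a large multiple of \<open>f x * r\<^sup>2\<close> on a fixed portion of every dyadic ring of radii
  \<open>r\<close> and \<open>r / 2\<close> below $\rho_0 2^{-1/(2-\alpha)}$, the geometric series of ratio $2^{-(2-\alpha)}$ would
  compensate the factor $2-\alpha$ and violate this bound. Finitely many rings, with a number depending
  on \<open>\<alpha>\<close> only, already suffice for the contradiction, so each contact point has a good scale among
  finitely many. On a good ring, concavity bounds \<open>P - \<Gamma>\<close> in the half ball, which gives the gradient
  estimate and the measure estimate for every cube of that scale containing \<open>x\<close>. Subdividing a large
  cube dyadically and stopping at good cubes therefore ends after boundedly many steps; no limit
  of nested cubes, and hence no closedness of the contact set, is needed.
\<close>

section \<open>Cubes and dyadic subdivision\<close>

lemma cube_centre:
  "(c - (s / 2) *\<^sub>R One) \<bullet> i = c \<bullet> i - s / 2" "(c + (s / 2) *\<^sub>R One) \<bullet> i = c \<bullet> i + s / 2"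
  if "i \<in> Basis" for c :: "'a::euclidean_space"
  using that by (simp_all add: inner_diff_left inner_add_left)

lemma mem_open_cube:
  "x \<in> open_cube c s \<longleftrightarrow> (\<forall>i\<in>Basis. c \<bullet> i - s / 2 < x \<bullet> i \<and> x \<bullet> i < c \<bullet> i + s / 2)"
  unfolding open_cube_def mem_box by (simp add: cube_centre)

lemma closure_open_cube:
  "0 < s \<Longrightarrow> closure (open_cube c s) = cbox (c - (s / 2) *\<^sub>R One) (c + (s / 2) *\<^sub>R One)"
  unfolding open_cube_def by (rule closure_box) (auto simp: box_ne_empty cube_centre)

lemma mem_closure_open_cube:
  assumes "0 < s"
  shows "x \<in> closure (open_cube c s) \<longleftrightarrow>
    (\<forall>i\<in>Basis. c \<bullet> i - s / 2 \<le> x \<bullet> i \<and> x \<bullet> i \<le> c \<bullet> i + s / 2)"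
  unfolding closure_open_cube[OF assms] mem_box by (simp add: cube_centre)

lemma measure_open_cube:
  "0 < s \<Longrightarrow> measure lebesgue (open_cube (c::'a::euclidean_space) s) = s ^ DIM('a)"
  "0 < s \<Longrightarrow> measure lebesgue (closure (open_cube c s)) = s ^ DIM('a)"
  by (simp_all add: closure_open_cube)
    (simp_all add: open_cube_def measure_lborel_box_eq measure_lborel_cbox_eq cube_centre inner_diff_left)

lemma diameter_open_cube:
  assumes "0 < s"
  shows "diameter (open_cube (c::'a::euclidean_space) s) = sqrt DIM('a) * s"
proof -
  have "diameter (open_cube c s) = diameter (closure (open_cube c s))"
    by (simp add: open_cube_def diameter_closure)
  also have "\<dots> = dist (c - (s / 2) *\<^sub>R One) (c + (s / 2) *\<^sub>R One)"
    using assms unfolding closure_open_cube[OF assms]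
    by (intro diameter_cbox) (simp add: cube_centre)
  also have "\<dots> = sqrt (\<Sum>i\<in>(Basis::'a set). s\<^sup>2)"
  proof -
    have "(dist ((c - (s / 2) *\<^sub>R One) \<bullet> i) ((c + (s / 2) *\<^sub>R One) \<bullet> i))\<^sup>2 = s\<^sup>2"
      if "i \<in> Basis" for i
      unfolding cube_centre[OF that] dist_real_def by simp
    then show ?thesis unfolding euclidean_dist_l2[of "c - (s / 2) *\<^sub>R One"] L2_set_def
      by (intro arg_cong[where f = sqrt] sum.cong) auto
  qed
  also have "\<dots> = sqrt DIM('a) * s"
    using assms by (simp add: real_sqrt_mult)
  finally show ?thesis .
qed

text \<open>Serves to bound the volume of a ball from above and to enclose the unit ball in the
  starting cube.\<close>

lemma ball_subset_open_cube: "ball x r \<subseteq> open_cube x (2 * r)"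
proof
  fix y assume "y \<in> ball x r"
  then have "\<bar>(y - x) \<bullet> i\<bar> < r" if "i \<in> Basis" for i
    using Basis_le_norm[OF that, of "y - x"] by (simp add: dist_norm norm_minus_commute)
  then show "y \<in> open_cube x (2 * r)" by (force simp: mem_open_cube inner_diff_left abs_less_iff)
qed

text \<open>The subsets \<open>A\<close> of \<open>Basis\<close> index the 2^d half-size subcubes:
  \<open>A\<close> collects the coordinates in which the subcube lies on the upper side of the
  centre \<open>c\<close>.\<close>

definition subcube_centre :: "'a::euclidean_space \<Rightarrow> real \<Rightarrow> 'a set \<Rightarrow> 'a" where
  "subcube_centre c s A = c + (\<Sum>i\<in>Basis. (if i \<in> A then s / 4 else - (s / 4)) *\<^sub>R i)"

lemma subcube_centre_inner:
  "i \<in> Basis \<Longrightarrow> subcube_centre c s A \<bullet> i = c \<bullet> i + (if i \<in> A then s / 4 else - (s / 4))"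
  unfolding subcube_centre_def by (simp add: inner_add_left)

lemma subcube_subset: "open_cube (subcube_centre c s A) (s / 2) \<subseteq> open_cube c s"
proof
  fix x assume x: "x \<in> open_cube (subcube_centre c s A) (s / 2)"
  have "c \<bullet> i - s / 2 < x \<bullet> i \<and> x \<bullet> i < c \<bullet> i + s / 2" if "i \<in> Basis" for i
  proof -
    \<comment> \<open>Positivity of the side is not assumed; the existence of a point in the cube
      forces it.\<close>
    have "0 < s" using x that unfolding mem_open_cube by (fastforce dest!: bspec[of _ _ i])
    then show ?thesis
      using x that unfolding mem_open_cube
      by (auto simp: subcube_centre_inner dest!: bspec[of _ _ i] split: if_splits)
  qed
  then show "x \<in> open_cube c s" by (simp add: mem_open_cube)
qed

lemma subcube_disjoint:
  assumes "A \<subseteq> Basis" "B \<subseteq> Basis" "A \<noteq> B"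
  shows "open_cube (subcube_centre c s A) (s / 2) \<inter> open_cube (subcube_centre c s B) (s / 2) = {}"
proof -
  obtain i where i: "i \<in> Basis" "i \<in> A \<longleftrightarrow> i \<notin> B" using assms by blast
  have False if "x \<in> open_cube (subcube_centre c s A) (s / 2)"
    "x \<in> open_cube (subcube_centre c s B) (s / 2)" for x
    using that[unfolded mem_open_cube, THEN bspec, OF i(1)] i
    by (auto simp: subcube_centre_inner split: if_splits)
  then show ?thesis by blast
qed

lemma subcube_cover:
  assumes "0 < s" "x \<in> closure (open_cube c s)"
  obtains A where "A \<subseteq> Basis" "x \<in> closure (open_cube (subcube_centre c s A) (s / 2))"
proof
  \<comment> \<open>Points on a dividing hyperplane are assigned to the upper side; the closed
    subcubes overlap there.\<close>
  let ?A = "{i\<in>Basis. c \<bullet> i \<le> x \<bullet> i}"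
  show "x \<in> closure (open_cube (subcube_centre c s ?A) (s / 2))"
    using assms by (auto simp: mem_closure_open_cube subcube_centre_inner dest!: bspec)
qed auto

text \<open>Stopping-time argument: a cube satisfying \<open>G\<close> is kept, any other is split.
  \<open>N\<close> bounds the depth, and for \<open>N = 0\<close> the assumption says that
  \<open>S\<close> misses the closed cube. Since the assumption concerns all cubes of a given side
  containing \<open>x\<close>, it does not matter where the dyadic grid lies.\<close>

lemma dyadic_tiling:
  fixes c :: "'a::euclidean_space"
  assumes "0 < s"
    and "\<And>x. x \<in> S \<Longrightarrow> x \<in> closure (open_cube c s) \<Longrightarrow>
      \<exists>k<N. \<forall>c'. x \<in> closure (open_cube c' (s / 2 ^ k)) \<longrightarrow> G c' (s / 2 ^ k)"
  shows "\<exists>F. finite F \<and>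
    (\<forall>p\<in>F. 0 < snd p \<and> open_cube (fst p) (snd p) \<subseteq> open_cube c s \<and> G (fst p) (snd p)) \<and>
    (\<forall>p\<in>F. \<forall>q\<in>F. p \<noteq> q \<longrightarrow> open_cube (fst p) (snd p) \<inter> open_cube (fst q) (snd q) = {}) \<and>
    S \<inter> closure (open_cube c s) \<subseteq> (\<Union>p\<in>F. closure (open_cube (fst p) (snd p)))"
  using assms
proof (induction N arbitrary: c s)
  case 0
  then have "S \<inter> closure (open_cube c s) = {}" by blast
  then show ?case by (intro exI[of _ "{}"]) auto
next
  case (Suc N)
  show ?case
  proof (cases "G c s")
    case True
    then show ?thesis using \<open>0 < s\<close> by (intro exI[of _ "{(c, s)}"]) auto
  next
    case False
    \<comment> \<open>\<open>?T A F\<close> says that \<open>F\<close> is a tiling as claimed, for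
      the subcube with index \<open>A\<close>.\<close>
    let ?T = "\<lambda>A F. finite F \<and>
      (\<forall>p\<in>F. 0 < snd p \<and> open_cube (fst p) (snd p) \<subseteq> open_cube (subcube_centre c s A) (s / 2) \<and> G (fst p) (snd p)) \<and>
      (\<forall>p\<in>F. \<forall>q\<in>F. p \<noteq> q \<longrightarrow> open_cube (fst p) (snd p) \<inter> open_cube (fst q) (snd q) = {}) \<and>
      S \<inter> closure (open_cube (subcube_centre c s A) (s / 2)) \<subseteq> (\<Union>p\<in>F. closure (open_cube (fst p) (snd p)))"
    have "\<forall>A. \<exists>F. ?T A F"
    proof (rule allI, rule Suc.IH)
      fix A x assume x: "x \<in> S" "x \<in> closure (open_cube (subcube_centre c s A) (s / 2))"
      then have xc: "x \<in> closure (open_cube c s)" using closure_mono[OF subcube_subset] by blast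
      obtain k where k: "k < Suc N" "\<forall>c'. x \<in> closure (open_cube c' (s / 2 ^ k)) \<longrightarrow> G c' (s / 2 ^ k)"
        using Suc.prems(2)[OF x(1) xc] by blast
      \<comment> \<open>The good level of \<open>x\<close> is not 0, because the present cube
        contains \<open>x\<close> in its closure and fails \<open>G\<close>. Relative to the subcube
        the level drops by one.\<close>
      then obtain k' where "k = Suc k'" using False xc by (cases k) auto
      then show "\<exists>k<N. \<forall>c'. x \<in> closure (open_cube c' (s / 2 / 2 ^ k)) \<longrightarrow> G c' (s / 2 / 2 ^ k)"
        using k by (intro exI[of _ k']) (simp add: field_simps)
    qed (use Suc.prems in simp)
    from choice[OF this] obtain F where "\<forall>A. ?T A (F A)" ..
    then have F: "?T A (F A)" for A by (rule spec)
    show ?thesis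
    proof (intro exI[of _ "\<Union>(F ` Pow Basis)"] conjI ballI impI)
      show "finite (\<Union>(F ` Pow Basis))" using F by simp
      show "S \<inter> closure (open_cube c s) \<subseteq> (\<Union>p\<in>\<Union>(F ` Pow Basis). closure (open_cube (fst p) (snd p)))"
      proof
        fix x assume x: "x \<in> S \<inter> closure (open_cube c s)"
        then obtain A where A: "A \<subseteq> Basis" "x \<in> closure (open_cube (subcube_centre c s A) (s / 2))"
          using subcube_cover[OF \<open>0 < s\<close>] by blast
        then have "x \<in> (\<Union>p\<in>F A. closure (open_cube (fst p) (snd p)))" using F[of A] x by blast
        then show "x \<in> (\<Union>p\<in>\<Union>(F ` Pow Basis). closure (open_cube (fst p) (snd p)))" using A by blast
      qed
    next
      fix p assume "p \<in> \<Union>(F ` Pow Basis)"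
      then obtain A where "p \<in> F A" by blast
      then show "0 < snd p" "G (fst p) (snd p)" "open_cube (fst p) (snd p) \<subseteq> open_cube c s"
        using F[of A] subcube_subset[of c s A] by blast+
    next
      fix p q assume "p \<in> \<Union>(F ` Pow Basis)" "q \<in> \<Union>(F ` Pow Basis)" "p \<noteq> q"
      then obtain A B where AB: "p \<in> F A" "q \<in> F B" "A \<subseteq> Basis" "B \<subseteq> Basis" by blast
      show "open_cube (fst p) (snd p) \<inter> open_cube (fst q) (snd q) = {}"
      proof (cases "A = B")
        case True
        then show ?thesis using F[of A] AB \<open>p \<noteq> q\<close> by blast
      next
        case False
        have "open_cube (fst p) (snd p) \<subseteq> open_cube (subcube_centre c s A) (s / 2)"
          "open_cube (fst q) (snd q) \<subseteq> open_cube (subcube_centre c s B) (s / 2)"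
          using F[of A] F[of B] AB by blast+
        then show ?thesis using subcube_disjoint[OF AB(3,4) False, of c s] by blast
      qed
    qed
  qed
qed

section \<open>The concave envelope\<close>

lemma concave_envelope_le:
  assumes "\<forall>y\<in>ball 0 3. max 0 (u y) \<le> a + b \<bullet> y" "x \<in> ball 0 3"
  shows "concave_envelope u x \<le> a + b \<bullet> x"
proof -
  \<comment> \<open>Every competing plane dominates \<open>max 0 (u x)\<close> at \<open>x\<close>,
    so 0 is a lower bound.\<close>
  have "bdd_below {a + b \<bullet> x | a b. \<forall>y\<in>ball 0 3. max 0 (u y) \<le> a + b \<bullet> y}"
    using assms(2) by (intro bdd_belowI[of _ 0]) fastforce
  then show ?thesis
    using assms unfolding concave_envelope_def by (auto intro!: cInf_lower)
qed

text \<open>Boundedness of \<open>u\<close> supplies a constant competitor, so the infimum is over a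
  nonempty set.\<close>

lemma concave_envelope_greatest:
  assumes "bounded (range u)" "x \<in> ball 0 3"
    and "\<And>a b. \<forall>y\<in>ball 0 3. max 0 (u y) \<le> a + b \<bullet> y \<Longrightarrow> t \<le> a + b \<bullet> x"
  shows "t \<le> concave_envelope u x"
proof -
  obtain K where "\<And>y. \<bar>u y\<bar> \<le> K" using assms(1) by (auto simp: bounded_iff)
  then have "\<forall>y\<in>ball 0 3. max 0 (u y) \<le> K + 0 \<bullet> y"
    by (smt (verit) inner_zero_left)
  then have "{a + b \<bullet> x | a b. \<forall>y\<in>ball 0 3. max 0 (u y) \<le> a + b \<bullet> y} \<noteq> {}" by blast
  moreover have "t \<le> z" if "z \<in> {a + b \<bullet> x | a b. \<forall>y\<in>ball 0 3. max 0 (u y) \<le> a + b \<bullet> y}" for z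
    using that assms(3) by blast
  ultimately show ?thesis
    unfolding concave_envelope_def if_P[OF assms(2)] by (rule cInf_greatest)
qed

lemma concave_envelope_ge:
  assumes "bounded (range u)" "x \<in> ball 0 3"
  shows "max 0 (u x) \<le> concave_envelope u x"
  using assms by (intro concave_envelope_greatest) auto

text \<open>Each competing plane bounds both values on the left and is affine, hence bounds their
  convex combination; the infimum inherits this.\<close>

lemma concave_on_concave_envelope:
  assumes "bounded (range u)"
  shows "concave_on (ball 0 3) (concave_envelope u)"
  unfolding concave_on_iff
proof (intro conjI ballI allI impI)
  fix x y :: 'a and s t :: real
  assume xy: "x \<in> ball 0 3" "y \<in> ball 0 3" and st: "0 \<le> s" "0 \<le> t" "s + t = 1"
  show "s * concave_envelope u x + t * concave_envelope u y \<le> concave_envelope u (s *\<^sub>R x + t *\<^sub>R y)"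
  proof (rule concave_envelope_greatest)
    fix a b assume ab: "\<forall>y\<in>ball 0 3. max 0 (u y) \<le> a + b \<bullet> y"
    have "s * concave_envelope u x + t * concave_envelope u y \<le> s * (a + b \<bullet> x) + t * (a + b \<bullet> y)"
      using concave_envelope_le[OF ab] xy st by (intro add_mono mult_left_mono) auto
    also have "\<dots> = (s + t) * a + b \<bullet> (s *\<^sub>R x + t *\<^sub>R y)" by (simp add: inner_add_right algebra_simps)
    finally show "s * concave_envelope u x + t * concave_envelope u y \<le> a + b \<bullet> (s *\<^sub>R x + t *\<^sub>R y)"
      using st by simp
  qed (use assms convexD[OF convex_ball xy st] in auto)
qed simp

text \<open>A convex function on an open set is continuous, so the envelope is continuous in the
  ball, and the extension by 0 is Borel.\<close>

lemma concave_envelope_measurable: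
  assumes "bounded (range u)"
  shows "concave_envelope u \<in> borel_measurable lebesgue"
proof -
  have "continuous_on (ball 0 3) (\<lambda>x. - concave_envelope u x)"
    using concave_on_concave_envelope[OF assms] unfolding concave_on_def
    by (intro convex_on_continuous) auto
  then have "continuous_on (ball 0 3) (\<lambda>x. - (- concave_envelope u x))" by (rule continuous_on_minus)
  then have "(\<lambda>x. if x \<in> ball 0 3 then - (- concave_envelope u x) else 0) \<in> borel_measurable borel"
    by (intro borel_measurable_continuous_on_if) auto
  also have "(\<lambda>x. if x \<in> ball 0 3 then - (- concave_envelope u x) else 0) = concave_envelope u"
    by (auto simp: concave_envelope_def)
  finally show ?thesis by (simp add: measurable_completion)
qed

text \<open>Near-optimal planes at an interior point have bounded slope, so the infimum is attained.\<close>

lemma superdifferential_nonempty: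
  assumes "bounded (range u)" "x \<in> ball 0 1"
  shows "superdifferential (ball 0 3) (concave_envelope u) x \<noteq> {}"
proof -
  obtain K where K: "\<And>y. \<bar>u y\<bar> \<le> K" using assms(1) by (auto simp: bounded_iff)
  have x3: "x \<in> ball 0 3" using assms(2) by simp
  \<comment> \<open>A pair holds the value at \<open>x\<close> and the slope of a competing plane.
    The cap \<open>K\<close> on the value makes \<open>A\<close> compact without losing the
    minimum.\<close>
  define A where "A = {(p, b). p \<le> K \<and> (\<forall>y\<in>ball 0 3. max 0 (u y) \<le> p + b \<bullet> (y - x))}"
  have "closed A"
  proof -
    have "A = {q. fst q \<le> K} \<inter> (\<Inter>y\<in>ball 0 3. {q. max 0 (u y) \<le> fst q + snd q \<bullet> (y - x)})"
      by (auto simp: A_def)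
    then show ?thesis by (auto simp del: max.bounded_iff intro!: closed_Int closed_INT closed_Collect_le continuous_intros)
  qed
  moreover have "bounded A"
  proof -
    have "\<bar>p\<bar> \<le> K \<and> norm b \<le> K" if "(p, b) \<in> A" for p b
    proof
      have pos: "0 \<le> p + b \<bullet> (y - x)" if "y \<in> ball 0 3" for y
        using \<open>(p, b) \<in> A\<close> that by (fastforce simp: A_def)
      show "\<bar>p\<bar> \<le> K" using pos[OF x3] that by (auto simp: A_def)
      show "norm b \<le> K"
      proof (cases "b = 0")
        case True
        then show ?thesis using K[of x] by simp
      next
        case False
        \<comment> \<open>Moving from \<open>x\<close> by a unit step against \<open>b\<close> stays
          in the ball of radius 3. The plane is nonnegative there, so its slope is at most its value
          at \<open>x\<close>.\<close>
        have "norm (x - b /\<^sub>R norm b) < 3"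
          using norm_triangle_ineq4[of x "b /\<^sub>R norm b"] assms(2) False by simp
        then have "0 \<le> p + b \<bullet> (x - b /\<^sub>R norm b - x)" by (intro pos) simp
        also have "\<dots> = p - norm b"
          using False by (simp add: dot_square_norm power2_eq_square)
        finally show ?thesis using that by (auto simp: A_def)
      qed
    qed
    then have "A \<subseteq> {-K..K} \<times> cball 0 K" by force
    then show ?thesis by (rule bounded_subset[rotated]) (intro bounded_Times; simp)
  qed
  ultimately have "compact A" by (simp add: compact_eq_bounded_closed)
  moreover have "(K, 0) \<in> A" using K by (auto simp: A_def intro: order_trans[OF abs_ge_self] order_trans[OF abs_ge_zero])
  ultimately obtain q where q: "q \<in> A" "\<And>r. r \<in> A \<Longrightarrow> fst q \<le> fst r"
    using continuous_attains_inf[of A fst] continuous_on_fst[OF continuous_on_id] by blast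
  obtain p b where pb: "q = (p, b)" by fastforce
  have plane: "\<forall>y\<in>ball 0 3. max 0 (u y) \<le> (p - b \<bullet> x) + b \<bullet> y" and "p \<le> K"
    using q(1) by (auto simp: A_def pb inner_diff_right)
  have "p \<le> concave_envelope u x"
  proof (rule concave_envelope_greatest[OF assms(1) x3])
    \<comment> \<open>Planes with value at \<open>x\<close> above \<open>K\<close> are outside
      \<open>A\<close>, but they exceed \<open>p\<close> trivially.\<close>
    fix a c assume ac: "\<forall>y\<in>ball 0 3. max 0 (u y) \<le> a + c \<bullet> y"
    show "p \<le> a + c \<bullet> x"
    proof (cases "a + c \<bullet> x \<le> K")
      case True
      then have "(a + c \<bullet> x, c) \<in> A" using ac by (simp add: A_def inner_diff_right)
      then show ?thesis using q(2) pb by fastforce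
    qed (use \<open>p \<le> K\<close> in simp)
  qed
  then have "b \<in> superdifferential (ball 0 3) (concave_envelope u) x"
    using concave_envelope_le[OF plane] by (fastforce simp: superdifferential_def inner_diff_right)
  then show ?thesis by blast
qed

text \<open>If the envelope falls below \<open>P - h\<close> at a point of the half ball, then it does so on a half
  space, and that half space contains a ball of radius \<open>r / 4\<close> inside the ring.\<close>

lemma concave_ring_ball:
  fixes g :: "'a::euclidean_space \<Rightarrow> real"
  assumes "concave_on (ball x r) g" "z \<in> ball x (r / 2)" "g z < p + b \<bullet> (z - x) - h"
  obtains e where "norm e = 3 / 4 * r"
    "\<And>y. y \<in> ball (x + e) (r / 4) \<Longrightarrow> g y < p + b \<bullet> (y - x) - h"
proof -
  have r: "0 < r" using assms(2) zero_le_dist[of x z] unfolding mem_ball by linarith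
  \<comment> \<open>The set where the concave function stays above the lowered plane is convex and
    misses \<open>z\<close>; a hyperplane through \<open>z\<close> can be placed on one side of
    it.\<close>
  define S where "S = {y \<in> ball x r. p + b \<bullet> (y - x) - h \<le> g y}"
  have "convex S"
  proof (rule convexI)
    fix y w and s t :: real assume yw: "y \<in> S" "w \<in> S" and st: "0 \<le> s" "0 \<le> t" "s + t = 1"
    have "s *\<^sub>R y + t *\<^sub>R w \<in> ball x r"
      using yw st convex_ball[of x r] by (auto simp: S_def convex_def)
    moreover have "s * (p + b \<bullet> (y - x) - h) + t * (p + b \<bullet> (w - x) - h) \<le> g (s *\<^sub>R y + t *\<^sub>R w)"
    proof -
      have "s * g y + t * g w \<le> g (s *\<^sub>R y + t *\<^sub>R w)"
        using assms(1) yw st unfolding concave_on_iff S_def by blast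
      moreover have "s * (p + b \<bullet> (y - x) - h) + t * (p + b \<bullet> (w - x) - h) \<le> s * g y + t * g w"
        using yw st by (intro add_mono mult_left_mono) (auto simp: S_def)
      ultimately show ?thesis by linarith
    qed
    moreover have "s * (p + b \<bullet> (y - x) - h) + t * (p + b \<bullet> (w - x) - h) =
        (s + t) * (p - b \<bullet> x - h) + b \<bullet> (s *\<^sub>R y + t *\<^sub>R w)"
      by (simp add: inner_add_right inner_diff_right algebra_simps)
    ultimately show "s *\<^sub>R y + t *\<^sub>R w \<in> S" using st by (simp add: S_def inner_diff_right)
  qed
  have "z \<notin> S" using assms(3) by (simp add: S_def)
  obtain a where a: "a \<noteq> 0" "\<And>y. y \<in> S \<Longrightarrow> a \<bullet> y \<le> a \<bullet> z"
  proof (cases "S = {}")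
    case True
    obtain a :: 'a where "a \<noteq> 0" using nonzero_Basis nonempty_Basis by blast
    then show ?thesis using that True by blast
  next
    case False
    then obtain a c where "a \<noteq> 0" "\<forall>y\<in>S. a \<bullet> y \<le> c" "\<forall>y\<in>{z}. c \<le> a \<bullet> y"
      using separating_hyperplane_sets[of S "{z}"] \<open>convex S\<close> \<open>z \<notin> S\<close> by (metis convex_singleton disjoint_insert(1) inf_bot_right insert_not_empty)
    then show ?thesis using that by force
  qed
  \<comment> \<open>Along the separating normal, 3/4 - 1/4 = 1/2 keeps the whole small ball beyond
    \<open>z\<close>, which lies within \<open>r / 2\<close> of \<open>x\<close>; and 3/4 + 1/4 = 1
    keeps it within radius \<open>r\<close>.\<close>
  define e where "e = (3 / 4 * r / norm a) *\<^sub>R a"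
  show ?thesis
  proof
    show e: "norm e = 3 / 4 * r" using a(1) r by (simp add: e_def)
    fix y assume y: "y \<in> ball (x + e) (r / 4)"
    have "norm (y - x) \<le> norm (y - (x + e)) + norm e"
      using norm_triangle_ineq[of "y - (x + e)" e] by (simp add: algebra_simps)
    then have "y \<in> ball x r" using y e by (simp add: dist_norm norm_minus_commute)
    moreover have "a \<bullet> z < a \<bullet> y"
    proof -
      have "a \<bullet> (z - x) \<le> norm a * norm (z - x)" by (rule norm_cauchy_schwarz)
      also have "\<dots> < norm a * (r / 2)"
        using assms(2) a(1) by (simp add: dist_norm norm_minus_commute)
      finally have 1: "a \<bullet> (z - x) < norm a * r / 2" by simp
      have "a \<bullet> (x + e - y) \<le> norm a * norm (x + e - y)" by (rule norm_cauchy_schwarz)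
      also have "\<dots> < norm a * (r / 4)"
        using y a(1) by (simp add: dist_norm)
      finally have 2: "a \<bullet> (x + e - y) < norm a * r / 4" by simp
      have "a \<bullet> e = 3 * (norm a * r) / 4"
        using a(1) by (simp add: e_def dot_square_norm power2_eq_square)
      then show ?thesis using 1 2 unfolding inner_diff_right inner_add_right by linarith
    qed
    ultimately show "g y < p + b \<bullet> (y - x) - h" using a(2)[of y] by (cases "y \<in> S") (auto simp: S_def not_le)
  qed
qed

text \<open>A step of length \<open>t\<close> from \<open>y\<close> against \<open>b' - b\<close>
  lowers the plane through \<open>y\<close> of slope \<open>b'\<close> by
  \<open>t * norm (b' - b)\<close> relative to the plane of slope \<open>b\<close>. As
  \<open>g\<close> stays within \<open>h\<close> of the latter, this loss is at most
  \<open>h\<close>.\<close>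

lemma superdifferential_near:
  fixes g :: "'a::euclidean_space \<Rightarrow> real"
  assumes below: "\<And>z. z \<in> ball x R \<Longrightarrow> g z \<le> p + b \<bullet> (z - x)"
    and above: "\<And>z. z \<in> ball x r \<Longrightarrow> p + b \<bullet> (z - x) - h \<le> g z"
    and "ball x r \<subseteq> S" "r \<le> R" "0 < t" "dist x y + t < r" "b' \<in> superdifferential S g y"
  shows "norm (b' - b) \<le> h / t"
proof -
  \<comment> \<open>For \<open>b' = b\<close> this is 0, which is why only
    \<open>norm e \<le> t\<close> is claimed.\<close>
  define e where "e = (t / norm (b' - b)) *\<^sub>R (b' - b)"
  have "norm e \<le> t" using \<open>0 < t\<close> by (simp add: e_def)
  then have "dist x (y - e) < r"
    using dist_triangle[of x "y - e" y] assms(6) by (simp add: dist_norm)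
  then have z: "y - e \<in> ball x r" by simp
  have "dist x y < r" using assms(5,6) by linarith
  then have "g y \<le> p + b \<bullet> (y - x)" using below[of y] \<open>r \<le> R\<close> by simp
  moreover have "p + b \<bullet> (y - e - x) - h \<le> g (y - e)" using above[OF z] .
  moreover have "g (y - e) \<le> g y + b' \<bullet> (y - e - y)"
    using assms(3,7) z unfolding superdifferential_def by blast
  ultimately have "(b' - b) \<bullet> e \<le> h" by (simp add: inner_diff_right inner_diff_left)
  moreover have "(b' - b) \<bullet> e = norm (b' - b) * t"
    by (simp add: e_def dot_square_norm power2_eq_square)
  ultimately show ?thesis using \<open>0 < t\<close> by (simp add: field_simps)
qed

section \<open>The equation at a contact point\<close>

lemma emeasure_ball_le:
  assumes "0 < r"
  shows "emeasure lebesgue (ball (x::'a::euclidean_space) r) \<le> ennreal ((2 * r) ^ DIM('a))"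
proof -
  have "emeasure lebesgue (ball x r) \<le> emeasure lebesgue (open_cube x (2 * r))"
    by (rule emeasure_mono[OF ball_subset_open_cube]) (simp add: open_cube_def)
  also have "\<dots> = ennreal (measure lebesgue (open_cube x (2 * r)))"
    using emeasure_lborel_box_finite unfolding open_cube_def
    by (intro emeasure_eq_ennreal_measure) (simp add: less_top)
  also have "\<dots> = ennreal ((2 * r) ^ DIM('a))"
    using assms by (subst measure_open_cube) auto
  finally show ?thesis .
qed

lemma exists_dyadic_scale:
  fixes r t :: real
  assumes "0 < r" "r \<le> t"
  obtains k where "r * 2 ^ k \<le> t" "t < r * 2 ^ Suc k"
proof -
  obtain n where "t / r < 2 ^ n" using real_arch_pow[of 2 "t / r"] by auto
  then have n: "t < r * 2 ^ n" using assms by (simp add: field_simps)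
  define m where "m = (LEAST n. t < r * 2 ^ n)"
  have m: "t < r * 2 ^ m" unfolding m_def using n by (rule LeastI)
  then obtain k where k: "m = Suc k" using assms by (cases m) auto
  have "\<not> t < r * 2 ^ k" using not_less_Least[of k "\<lambda>n. t < r * 2 ^ n"] k unfolding m_def by simp
  then show ?thesis using that m k by force
qed

text \<open>On the annulus between radii \<open>r * 2 ^ k\<close> and \<open>r * 2 ^ Suc k\<close>
  the function is at most \<open>c k\<close>, while the volume grows like the d-th power of the
  radius. The contributions therefore decay like a geometric series of ratio
  \<open>2 powr - a\<close>.\<close>

lemma integrable_fractional_tail:
  fixes F :: "'a::euclidean_space \<Rightarrow> real"
  assumes [measurable]: "F \<in> borel_measurable lebesgue" and "0 < a" "0 < r" "0 \<le> K"
    and nonneg: "\<And>y. 0 \<le> F y" and zero: "\<And>y. norm y < r \<Longrightarrow> F y = 0"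
    and le: "\<And>y. r \<le> norm y \<Longrightarrow> F y \<le> K / (norm y ^ DIM('a) * norm y powr a)"
  shows "integrable lebesgue F"
proof (rule integrableI_nonneg)
  define c where "c k = K / ((r * 2 ^ k) ^ DIM('a) * (r * 2 ^ k) powr a)" for k
  \<comment> \<open>Full balls replace the annuli; the overlap only enlarges the majorant.\<close>
  define B where "B k = ball (0::'a) (r * 2 ^ Suc k)" for k
  have [measurable]: "B k \<in> sets lebesgue" for k by (simp add: B_def)
  have c0: "0 \<le> c k" for k using assms by (simp add: c_def)
  have term_le: "g k \<le> (\<Sum>k. g k)" for g :: "nat \<Rightarrow> ennreal" and k
    using sum_le_suminf[of g "{k}"] by simp
  have "ennreal (F y) \<le> (\<Sum>k. ennreal (c k) * indicator (B k) y)" for y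
  proof (cases "norm y < r")
    case False
    then obtain k where k: "r * 2 ^ k \<le> norm y" "norm y < r * 2 ^ Suc k"
      using exists_dyadic_scale[OF \<open>0 < r\<close>, of "norm y"] by auto
    have "0 < norm y" using False \<open>0 < r\<close> by linarith
    have "F y \<le> K / (norm y ^ DIM('a) * norm y powr a)" using le False by simp
    also have "\<dots> \<le> c k"
      unfolding c_def using k \<open>0 < norm y\<close> \<open>0 < r\<close> \<open>0 \<le> K\<close> \<open>0 < a\<close> False
      by (intro divide_left_mono mult_mono power_mono powr_mono2 mult_pos_pos) auto
    finally have "ennreal (F y) \<le> ennreal (c k) * indicator (B k) y"
      using k by (simp add: B_def ennreal_leI)
    also have "\<dots> \<le> (\<Sum>k. ennreal (c k) * indicator (B k) y)"
      by (rule term_le)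
    finally show ?thesis .
  qed (simp add: zero)
  then have "(\<integral>\<^sup>+ y. ennreal (F y) \<partial>lebesgue) \<le> (\<integral>\<^sup>+ y. (\<Sum>k. ennreal (c k) * indicator (B k) y) \<partial>lebesgue)"
    by (intro nn_integral_mono) auto
  also have "\<dots> = (\<Sum>k. ennreal (c k) * emeasure lebesgue (B k))"
    by (subst nn_integral_suminf) (auto simp: nn_integral_cmult_indicator)
  also have "\<dots> \<le> (\<Sum>k. ennreal (c k * (2 * (r * 2 ^ Suc k)) ^ DIM('a)))"
  proof (intro suminf_le allI)
    fix k
    show "ennreal (c k) * emeasure lebesgue (B k) \<le> ennreal (c k * (2 * (r * 2 ^ Suc k)) ^ DIM('a))"
      using emeasure_ball_le[of "r * 2 ^ Suc k" "0::'a"] c0[of k] \<open>0 < r\<close>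
      unfolding B_def by (subst ennreal_mult) (auto intro!: mult_left_mono)
  qed auto
  also have "\<dots> < \<infinity>"
  proof -
    have "c k * (2 * (r * 2 ^ Suc k)) ^ DIM('a) = K * 4 ^ DIM('a) * r powr - a * (2 powr - a) ^ k" for k
    proof -
      define t where "t = r * 2 ^ k"
      have "0 < t" using \<open>0 < r\<close> by (simp add: t_def)
      have "2 * (r * 2 ^ Suc k) = 4 * t" by (simp add: t_def)
      then have "c k * (2 * (r * 2 ^ Suc k)) ^ DIM('a) = K / (t ^ DIM('a) * t powr a) * (4 ^ DIM('a) * t ^ DIM('a))"
        by (simp only: c_def t_def power_mult_distrib[of 4])
      also have "\<dots> = K * 4 ^ DIM('a) * t powr - a"
        using \<open>0 < t\<close> by (simp add: powr_minus divide_inverse)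
      also have "t powr - a = r powr - a * (2 ^ k) powr - a"
        using \<open>0 < r\<close> by (simp add: t_def powr_mult)
      also have "(2 ^ k) powr - a = (2 powr - a) ^ k"
        by (simp add: powr_powr mult.commute flip: powr_realpow)
      finally show ?thesis by (simp add: mult.assoc)
    qed
    then have eq: "(\<lambda>k. c k * (2 * (r * 2 ^ Suc k)) ^ DIM('a)) =
        (\<lambda>k. K * 4 ^ DIM('a) * r powr - a * (2 powr - a) ^ k)" by (rule ext)
    have "(2::real) powr - a < 1" using \<open>0 < a\<close> by (simp add: powr_less_one)
    then have "summable (\<lambda>k. c k * (2 * (r * 2 ^ Suc k)) ^ DIM('a))"
      unfolding eq by (intro summable_mult summable_geometric) simp
    moreover have "0 \<le> c k * (2 * (r * 2 ^ Suc k)) ^ DIM('a)" for k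
      using c0[of k] \<open>0 < r\<close> by simp
    ultimately have "(\<Sum>k. ennreal (c k * (2 * (r * 2 ^ Suc k)) ^ DIM('a))) =
        ennreal (\<Sum>k. c k * (2 * (r * 2 ^ Suc k)) ^ DIM('a))"
      by (intro suminf_ennreal2) auto
    then show ?thesis by (simp only: ennreal_less_top infinity_ennreal_def)
  qed
  finally show "(\<integral>\<^sup>+ y. ennreal (F y) \<partial>lebesgue) < \<infinity>" .
qed (use nonneg in auto)

section \<open>Supporting planes as test functions at a contact point\<close>

lemma C2_affine: "C2 (\<lambda>y. p + b \<bullet> (y - x))"
  unfolding C2_def
  by (rule exI[of _ "\<lambda>_. blinfun_inner_right b"], rule exI[of _ "\<lambda>_. 0"])
    (auto intro!: derivative_eq_intros)

text \<open>Borel measurability of the inner map would not suffice for a Lebesgue measurable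
  \<open>u\<close>; translations and reflections are measurable from \<open>lebesgue\<close> to
  \<open>lebesgue\<close>.\<close>

lemma lebesgue_measurable_affine:
  fixes u :: "'a::euclidean_space \<Rightarrow> real"
  assumes "u \<in> borel_measurable lebesgue"
  shows "(\<lambda>y. u (x + y)) \<in> borel_measurable lebesgue" "(\<lambda>y. u (x - y)) \<in> borel_measurable lebesgue"
proof -
  have "(\<lambda>y. x + y) \<in> lebesgue \<rightarrow>\<^sub>M lebesgue"
    using lebesgue_affine_measurable[of "\<lambda>_. 1" x] by (simp add: euclidean_representation)
  moreover have "(\<lambda>y. x - y) \<in> lebesgue \<rightarrow>\<^sub>M lebesgue"
    using lebesgue_affine_measurable[of "\<lambda>_. - 1" x] by (simp add: euclidean_representation sum_negf)
  ultimately show "(\<lambda>y. u (x + y)) \<in> borel_measurable lebesgue" "(\<lambda>y. u (x - y)) \<in> borel_measurable lebesgue"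
    using measurable_compose[OF _ assms] by blast+
qed

text \<open>This is the term subtracted in the integrand of \<open>Mplus\<close>.\<close>

definition contact_kernel :: "real \<Rightarrow> real \<Rightarrow> ('a::euclidean_space \<Rightarrow> real) \<Rightarrow> 'a \<Rightarrow> 'a \<Rightarrow> real" where
  "contact_kernel lam \<alpha> u x y =
    lam * max 0 (- second_diff u x y) / norm y ^ DIM('a) * ((2 - \<alpha>) / norm y powr \<alpha>)"

text \<open>Fixes a contact point together with one supporting plane of the envelope there, of slope
  \<open>b\<close>; all estimates below refer to this plane.\<close>

locale contact_point =
  fixes u :: "'a::euclidean_space \<Rightarrow> real" and x b :: 'a
  assumes bounded: "bounded (range u)"
    and u_nonpos: "\<And>y. y \<notin> ball 0 1 \<Longrightarrow> u y \<le> 0"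
    and contact: "x \<in> contact_set u"
    and slope: "b \<in> superdifferential (ball 0 3) (concave_envelope u) x"
begin

definition gap :: "'a \<Rightarrow> real" where "gap y = u x + b \<bullet> (y - x) - u y"

lemma x_ball: "x \<in> ball 0 1" and envelope_x: "concave_envelope u x = u x"
  using contact by (auto simp: contact_set_def)

lemma envelope_le_plane: "y \<in> ball 0 3 \<Longrightarrow> concave_envelope u y \<le> u x + b \<bullet> (y - x)"
  using slope envelope_x by (force simp: superdifferential_def)

lemma u_le_envelope: "y \<in> ball 0 3 \<Longrightarrow> u y \<le> concave_envelope u y"
  using concave_envelope_ge[OF bounded] by force

lemma gap_nonneg: "y \<in> ball 0 3 \<Longrightarrow> 0 \<le> gap y"
  using envelope_le_plane u_le_envelope by (force simp: gap_def)

lemma u_x_nonneg: "0 \<le> u x"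
  using concave_envelope_ge[OF bounded, of x] x_ball envelope_x by simp

text \<open>The plane has no second differences, and the gap vanishes at \<open>x\<close>.\<close>

lemma second_diff_gap: "second_diff u x y = - gap (x + y) - gap (x - y)"
  by (simp add: second_diff_def gap_def)

lemma ball_subset: "norm y < 2 \<Longrightarrow> x + y \<in> ball 0 3" "norm y < 2 \<Longrightarrow> x - y \<in> ball 0 3"
  using x_ball norm_triangle_ineq[of x y] norm_triangle_ineq4[of x y] by auto

text \<open>For \<open>norm y < 2\<close> both points lie in the ball of radius 3, where the plane
  is above \<open>u\<close>. Otherwise both lie outside the unit ball, where
  \<open>u \<le> 0 \<le> u x\<close>.\<close>

lemma second_diff_nonpos: "second_diff u x y \<le> 0"
proof (cases "norm y < 2")
  case True
  then show ?thesis using gap_nonneg[OF ball_subset(1)[OF True]] gap_nonneg[OF ball_subset(2)[OF True]]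
    by (simp add: second_diff_gap)
next
  case False
  have "norm (x + y) \<ge> 1" "norm (x - y) \<ge> 1"
    using False x_ball norm_triangle_ineq2[of y "- x"] norm_triangle_ineq2[of y x]
    by (simp_all add: norm_minus_commute add.commute)
  then show ?thesis
    using u_nonpos[of "x + y"] u_nonpos[of "x - y"] u_x_nonneg by (simp add: second_diff_def)
qed

lemma gap_le_second_diff: "norm y < 2 \<Longrightarrow> gap (x + y) \<le> max 0 (- second_diff u x y)"
  using gap_nonneg[OF ball_subset(2), of y] by (simp add: second_diff_gap le_max_iff_disj)

lemma contact_kernel_nonneg: "0 < lam \<Longrightarrow> \<alpha> < 2 \<Longrightarrow> 0 \<le> contact_kernel lam \<alpha> u x y"
  by (simp add: contact_kernel_def)

text \<open>The test function is the supporting plane in \<open>ball x r\<close>. Truncating the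
  kernel at radius \<open>r\<close> makes it integrable; the rings used later lie outside the
  truncation.\<close>

lemma contact_integral:
  assumes meas: "u \<in> borel_measurable lebesgue" and "0 < lam" "0 < \<alpha>" "\<alpha> < 2"
    and visc: "viscosity_subsolution (Mplus lam Lam \<kappa> \<beta> \<alpha> \<phi> i) (ball 0 1) (\<lambda>x. - f x) u"
    and "0 < r" "cball x r \<subseteq> ball 0 1"
  defines "F \<equiv> \<lambda>y. if norm y < r then 0 else contact_kernel lam \<alpha> u x y"
  shows "integrable lebesgue F" "(LINT y|lebesgue. F y) \<le> f x"
proof -
  obtain K where K: "\<And>y. \<bar>u y\<bar> \<le> K" using bounded by (auto simp: bounded_iff)
  note [measurable] = lebesgue_measurable_affine[OF meas]
  have [measurable]: "(\<lambda>y::'a. y) \<in> borel_measurable lebesgue" by (simp add: measurable_completion)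
  show "integrable lebesgue F"
  proof (rule integrable_fractional_tail)
    show "F \<in> borel_measurable lebesgue"
      unfolding F_def contact_kernel_def second_diff_def by measurable
    fix y :: 'a assume "r \<le> norm y"
    have "- second_diff u x y \<le> 4 * K"
      using K[of x] K[of "x + y"] K[of "x - y"] by (simp add: second_diff_def)
    then have "max 0 (- second_diff u x y) \<le> 4 * K" using K[of x] by simp
    then have "lam * max 0 (- second_diff u x y) * (2 - \<alpha>) \<le> lam * (4 * K) * (2 - \<alpha>)"
      using \<open>0 < lam\<close> \<open>\<alpha> < 2\<close> by (intro mult_right_mono mult_left_mono) auto
    then show "F y \<le> lam * (4 * K) * (2 - \<alpha>) / (norm y ^ DIM('a) * norm y powr \<alpha>)"
      using \<open>r \<le> norm y\<close> by (simp add: F_def contact_kernel_def divide_right_mono)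
  qed (use assms K[of x] contact_kernel_nonneg in \<open>auto simp: F_def\<close>)
  define v where "v = (\<lambda>y. if y \<in> ball x r then u x + b \<bullet> (y - x) else u y)"
  have "- f x \<le> Mplus lam Lam \<kappa> \<beta> \<alpha> \<phi> i v x"
  proof -
    have test: "- f x \<le> Mplus lam Lam \<kappa> \<beta> \<alpha> \<phi> i (\<lambda>y. if y \<in> N then \<psi> y else u y) x"
      if "open N" "x \<in> N" "compact (closure N)" "closure N \<subseteq> ball 0 1" "C2 \<psi>"
        "\<forall>y\<in>N. u y \<le> \<psi> y" "\<psi> x = u x" for N \<psi>
      using visc x_ball that unfolding viscosity_subsolution_def by blast
    have "ball x r \<subseteq> ball 0 3"
      by (rule order_trans[OF ball_subset_cball order_trans[OF assms(7) subset_ball]]) simp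
    then have "\<forall>y\<in>ball x r. u y \<le> u x + b \<bullet> (y - x)"
      using gap_nonneg by (auto simp: gap_def subset_iff)
    moreover have "closure (ball x r) \<subseteq> ball 0 1" "compact (closure (ball x r))" "x \<in> ball x r"
      using assms(6,7) by auto
    ultimately show ?thesis
      using C2_affine unfolding v_def by (intro test) auto
  qed
  also have "\<dots> = (LINT y|lebesgue. - F y)"
    unfolding Mplus_def
  proof (rule Bochner_Integration.integral_cong[OF refl])
    fix y :: 'a
    \<comment> \<open>The points \<open>x + y\<close> and \<open>x - y\<close> are both in the small
      ball or both outside it. In the first case \<open>v\<close> is affine on all three points, in
      the second it agrees with \<open>u\<close>.\<close>
    have v: "second_diff v x y = (if norm y < r then 0 else second_diff u x y)"
      using \<open>0 < r\<close> by (simp add: v_def second_diff_def dist_norm)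
    have pos: "max 0 (second_diff v x y) = 0" using second_diff_nonpos[of y] by (simp add: v)
    have neg: "max 0 (- second_diff v x y) = (if norm y < r then 0 else max 0 (- second_diff u x y))"
      by (simp add: v)
    show "Lam * max 0 (second_diff v x y) / norm y ^ DIM('a) *
          ((2 - \<alpha>) / norm y powr \<alpha> + weight_scaled \<kappa> \<beta> \<alpha> \<phi> i (1 / norm y))
        - lam * max 0 (- second_diff v x y) / norm y ^ DIM('a) * ((2 - \<alpha>) / norm y powr \<alpha>) = - F y"
      by (simp only: pos neg) (simp add: F_def contact_kernel_def)
  qed
  finally show "(LINT y|lebesgue. F y) \<le> f x" by simp
qed

end

section \<open>Good scales\<close>

lemma emeasure_cball_le:
  assumes "0 \<le> r"
  shows "emeasure lebesgue (cball (x::'a::euclidean_space) r) \<le> ennreal ((2 * r) ^ DIM('a))"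
proof (cases "r = 0")
  case False
  have "emeasure lebesgue (cball x r) = emeasure lebesgue (ball x r)"
    using assms by (simp add: emeasure_cball emeasure_ball)
  then show ?thesis using emeasure_ball_le[of r x] False assms by simp
qed simp

lemma cube_subset_ball:
  fixes c :: "'a::euclidean_space"
  assumes "0 < s" "sqrt DIM('a) * s / 2 < r"
  shows "open_cube c s \<subseteq> ball c r"
proof
  fix y assume y: "y \<in> open_cube c s"
  have "\<bar>(y - c) \<bullet> i\<bar> \<le> s / 2" if "i \<in> Basis" for i
    using y[unfolded mem_open_cube, THEN bspec, OF that] unfolding inner_diff_left by linarith
  then have "infnorm (y - c) \<le> s / 2" unfolding infnorm_Max by (intro Max.boundedI) auto
  then have "norm (y - c) \<le> sqrt DIM('a) * (s / 2)"
    using norm_le_infnorm[of "y - c"] by (meson mult_left_mono order_trans real_sqrt_ge_zero of_nat_0_le_iff)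
  then show "y \<in> ball c r" using assms by (simp add: dist_norm norm_minus_commute)
qed

text \<open>A ball whose radius exceeds the half diagonal contains the cube, which gives a lower
  volume bound without the constant of the unit ball.\<close>

lemma measure_ball_ge:
  fixes c :: "'a::euclidean_space"
  assumes "0 < s" "sqrt DIM('a) * s / 2 < r"
  shows "s ^ DIM('a) \<le> measure lebesgue (ball c r)"
  using measure_mono_fmeasurable[OF cube_subset_ball[OF assms, of c], of lebesgue]
    measure_open_cube(1)[OF assms(1), of c]
  by (simp add: open_cube_def)

lemma sum_measure_le_integral:
  fixes F :: "'b \<Rightarrow> real" and N :: nat
  assumes "integrable M F" "\<And>y. 0 \<le> F y"
    and S: "\<And>k. k < N \<Longrightarrow> S k \<in> fmeasurable M" "disjoint_family_on S {..<N}"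
    and le: "\<And>k y. k < N \<Longrightarrow> y \<in> S k \<Longrightarrow> a k \<le> F y"
  shows "(\<Sum>k<N. a k * measure M (S k)) \<le> integral\<^sup>L M F"
proof -
  let ?G = "\<lambda>y. \<Sum>k<N. a k * indicator (S k) y"
  have int: "integrable M (\<lambda>y. a k * indicator (S k) y)" if "k < N" for k
    using S(1)[OF that] by (intro integrable_mult_right) (simp add: fmeasurable_def integrable_real_indicator)
  have "(\<Sum>k<N. a k * measure M (S k)) = (\<Sum>k<N. integral\<^sup>L M (\<lambda>y. a k * indicator (S k) y))"
    using S(1) by (intro sum.cong) (auto simp: fmeasurable_def)
  also have "\<dots> = integral\<^sup>L M ?G"
    using int by (intro Bochner_Integration.integral_sum[symmetric]) auto
  also have "\<dots> \<le> integral\<^sup>L M F"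
  proof (rule integral_mono)
    show "?G y \<le> F y" for y
    proof (cases "\<exists>j<N. y \<in> S j")
      case True
      then obtain j where j: "j < N" "y \<in> S j" by blast
      then have "k \<noteq> j \<Longrightarrow> k < N \<Longrightarrow> y \<notin> S k" for k using S(2) by (auto simp: disjoint_family_on_def)
      then have "?G y = (\<Sum>k\<in>{j}. a k * indicator (S k) y)"
        using j by (intro sum.mono_neutral_right) auto
      then show ?thesis using j le by simp
    next
      case False
      then show ?thesis using assms(2)[of y] by (simp add: indicator_def)
    qed
    show "integrable M ?G" using int by (intro Bochner_Integration.integrable_sum) auto
  qed (rule assms(1))
  finally show ?thesis .
qed

text \<open>With \<open>q = 2 powr - t\<close> one has \<open>1 - q \<le> t * ln 2 \<le> t\<close>,
  so \<open>t\<close> outweighs the denominator of the geometric sum. With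
  \<open>t = 2 - \<alpha>\<close> this makes the constants uniform in
  \<open>\<alpha>\<close>.\<close>

lemma geometric_sum_ge:
  fixes t :: real
  assumes "0 < t" "(2 powr - t) ^ N \<le> 1 / 2"
  shows "1 / 2 \<le> t * (\<Sum>k<N. (2 powr - t) ^ k)"
proof -
  define q :: real where "q = 2 powr - t"
  have q: "q < 1" using assms(1) by (simp add: q_def powr_less_one)
  have "1 - t * ln 2 \<le> q"
    using exp_ge_add_one_self[of "- t * ln 2"] by (simp add: q_def powr_def)
  moreover have "t * ln 2 \<le> t" using assms(1) ln_le_minus_one[of 2] by simp
  ultimately have "1 - q \<le> t" by linarith
  then have "1 * (1 / 2) \<le> t / (1 - q) * (1 - q ^ N)"
    using assms q by (intro mult_mono) (auto simp: q_def)
  also have "\<dots> = t * (\<Sum>k<N. q ^ k)" using q by (simp add: sum_gp_strict)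
  finally show ?thesis by (simp add: q_def)
qed

text \<open>The left side is the largest ring radius, three times the permitted diameter. Being at
  most 1, it keeps all rings around points of the unit ball inside the ball of radius 3.\<close>

lemma initial_radius_le_1:
  fixes d \<alpha> :: real
  assumes "1 \<le> d" "\<alpha> < 2"
  shows "3 / (16 * sqrt d) * 2 powr (- 1 / (2 - \<alpha>)) \<le> 1"
proof -
  have "3 \<le> 16 * sqrt d" using real_sqrt_ge_one[OF assms(1)] by linarith
  then have "3 / (16 * sqrt d) \<le> 1" using assms(1) by (simp add: divide_le_eq)
  moreover have "2 powr (- 1 / (2 - \<alpha>)) \<le> (1::real)"
    using assms(2) powr_mono[of "- 1 / (2 - \<alpha>)" 0 2] by simp
  ultimately have "3 / (16 * sqrt d) * 2 powr (- 1 / (2 - \<alpha>)) \<le> 1 * 1" by (intro mult_mono) auto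
  then show ?thesis by simp
qed

section \<open>Existence of a good scale at a contact point\<close>

context contact_point begin

lemma cball_subset_unit_ball: "r \<le> (1 - norm x) / 2 \<Longrightarrow> cball x r \<subseteq> ball 0 1"
proof
  fix y assume "r \<le> (1 - norm x) / 2" "y \<in> cball x r"
  then have "norm (y - x) \<le> (1 - norm x) / 2" by (simp add: dist_norm norm_minus_commute)
  then show "y \<in> ball 0 1" using norm_triangle_ineq[of x "y - x"] x_ball by simp
qed

lemma contact_rhs_nonneg:
  assumes "u \<in> borel_measurable lebesgue" "0 < lam" "0 < \<alpha>" "\<alpha> < 2"
    and "viscosity_subsolution (Mplus lam Lam \<kappa> \<beta> \<alpha> \<phi> i) (ball 0 1) (\<lambda>x. - f x) u"
  shows "0 \<le> f x"
proof -
  have "0 < (1 - norm x) / 2" using x_ball by simp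
  from contact_integral(2)[OF assms this cball_subset_unit_ball[OF order_refl]]
  show ?thesis
    by (rule order_trans[rotated])
      (intro Bochner_Integration.integral_nonneg, use assms contact_kernel_nonneg in simp)
qed

text \<open>A scale counts as good when this set has measure below that of a cube of side
  \<open>s\<close>, where \<open>r\<close> is three times the diameter of such a cube.\<close>

definition bad_ring :: "real \<Rightarrow> real \<Rightarrow> 'a set" where
  "bad_ring r h = {z. r / 2 \<le> dist x z \<and> dist x z < r \<and> h < gap z}"

lemma gap_measurable: "u \<in> borel_measurable lebesgue \<Longrightarrow> gap \<in> borel_measurable lebesgue"
proof -
  assume [measurable]: "u \<in> borel_measurable lebesgue"
  have [measurable]: "(\<lambda>y. u x + b \<bullet> (y - x)) \<in> borel_measurable lebesgue"
    by (intro measurable_completion) simp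
  show ?thesis unfolding gap_def by measurable
qed

lemma ring_fmeasurable: "{z. r / 2 \<le> dist x z \<and> dist x z < r} \<in> fmeasurable lebesgue"
proof -
  have "{z. r / 2 \<le> dist x z \<and> dist x z < r} = ball x r - ball x (r / 2)" by auto
  then show ?thesis by (simp add: fmeasurable_Diff)
qed

lemma bad_ring_fmeasurable:
  assumes "u \<in> borel_measurable lebesgue"
  shows "bad_ring r h \<in> fmeasurable lebesgue"
proof (rule fmeasurableI2[OF ring_fmeasurable])
  have "{z \<in> space lebesgue. h < gap z} \<in> sets lebesgue"
    using gap_measurable[OF assms] by measurable
  moreover have "bad_ring r h = {z. r / 2 \<le> dist x z \<and> dist x z < r} \<inter> {z \<in> space lebesgue. h < gap z}"
    by (auto simp: bad_ring_def)
  ultimately show "bad_ring r h \<in> sets lebesgue" using ring_fmeasurable by (auto intro: fmeasurableD)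
qed (auto simp: bad_ring_def)

text \<open>If all \<open>N\<close> rings were bad, summing their contributions to the contact
  integral would give at least \<open>2 * f x\<close>; the value of \<open>C\<close> is fixed for
  exactly this. The integral is at most \<open>f x\<close>, so only \<open>f x = 0\<close> remains,
  and then the kernel would have to vanish almost everywhere.\<close>

lemma exists_good_scale:
  assumes meas: "u \<in> borel_measurable lebesgue" and "0 < lam" "0 < \<alpha>" "\<alpha> < 2"
    and visc: "viscosity_subsolution (Mplus lam Lam \<kappa> \<beta> \<alpha> \<phi> i) (ball 0 1) (\<lambda>x. - f x) u"
    and "0 < s" and rs: "\<And>k. r k = 3 * sqrt DIM('a) * (s / 2 ^ k)"
    and r0: "r 0 = 3 / (16 * sqrt DIM('a)) * 2 powr (- 1 / (2 - \<alpha>))"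
    and N: "(2 powr - (2 - \<alpha>)) ^ N \<le> 1 / 2"
    and C: "lam * C * 9 = 2048 * real DIM('a) * (3 * sqrt DIM('a)) ^ DIM('a)"
  shows "\<exists>k<N. measure lebesgue (bad_ring (r k) (C * f x * (r k)\<^sup>2)) < (s / 2 ^ k) ^ DIM('a)"
proof (rule ccontr)
  let ?d = "real DIM('a)"
  have d: "1 \<le> ?d" using DIM_positive[where 'a='a] by linarith
  then have sqrt_d: "1 \<le> sqrt ?d" by (rule real_sqrt_ge_one)
  then have "3 \<le> 16 * sqrt ?d" by linarith
  then have rho_le: "3 / (16 * sqrt ?d) \<le> 1" using d by (simp add: divide_le_eq)
  define h where "h k = C * f x * (r k)\<^sup>2" for k
  assume contra: "\<not> ?thesis"
  have bad: "(s / 2 ^ k) ^ DIM('a) \<le> measure lebesgue (bad_ring (r k) (h k))" if "k < N" for k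
    using that contra by (metis h_def not_less)
  have rpos: "0 < r k" for k using \<open>0 < s\<close> d by (simp add: rs)
  have rSuc: "r (Suc k) = r k / 2" for k by (simp add: rs)
  have rmono: "r l \<le> r k" if "k \<le> l" for k l
    using that \<open>0 < s\<close> d unfolding rs by (intro mult_left_mono divide_left_mono power_increasing) auto
  have "r 0 \<le> 1" unfolding r0 by (rule initial_radius_le_1[OF d \<open>\<alpha> < 2\<close>])
  have N0: "0 < N" using N by (cases N) auto
  \<comment> \<open>The truncation radius lies below the inner radius of each of the
    \<open>N\<close> rings, since that of ring \<open>k\<close> is
    \<open>r (Suc k) \<ge> r N\<close>; the second bound keeps the test ball inside the unit
    ball.\<close>
  define \<epsilon> where "\<epsilon> = min (r N) ((1 - norm x) / 2)"
  have \<epsilon>: "0 < \<epsilon>" "\<epsilon> \<le> r N" using rpos[of N] x_ball by (auto simp: \<epsilon>_def)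
  have "cball x \<epsilon> \<subseteq> ball 0 1" by (rule cball_subset_unit_ball) (simp only: \<epsilon>_def min.cobounded2)
  note int = contact_integral[OF meas \<open>0 < lam\<close> \<open>0 < \<alpha>\<close> \<open>\<alpha> < 2\<close> visc \<epsilon>(1) this]
  define F where "F = (\<lambda>y. if norm y < \<epsilon> then 0 else contact_kernel lam \<alpha> u x y)"
  have F0: "0 \<le> F y" for y
    using contact_kernel_nonneg[OF \<open>0 < lam\<close> \<open>\<alpha> < 2\<close>] by (simp add: F_def)
  have Fint: "integrable lebesgue F" "(LINT y|lebesgue. F y) \<le> f x" using int by (simp_all add: F_def)
  have Fint0: "0 \<le> (LINT y|lebesgue. F y)" using F0 by (intro Bochner_Integration.integral_nonneg)
  have f0: "0 \<le> f x" using contact_rhs_nonneg[OF meas \<open>0 < lam\<close> \<open>0 < \<alpha>\<close> \<open>\<alpha> < 2\<close> visc] .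
  have C0: "0 < C"
  proof -
    have "0 < lam * C * 9" unfolding C using d by simp
    then show ?thesis using \<open>0 < lam\<close> by (simp add: zero_less_mult_iff)
  qed
  define S where "S k = (\<lambda>z. - x + z) ` bad_ring (r k) (h k)" for k
  have S_iff: "y \<in> S k \<longleftrightarrow> x + y \<in> bad_ring (r k) (h k)" for y k
    unfolding S_def by (force simp: image_iff)
  have measS: "measure lebesgue (S k) = measure lebesgue (bad_ring (r k) (h k))" for k
    unfolding S_def by (rule measure_translation)
  have Sf: "S k \<in> fmeasurable lebesgue" for k
    unfolding S_def using bad_ring_fmeasurable[OF meas] by (rule measurable_translation)
  have SD: "r k / 2 \<le> norm y \<and> norm y < r k \<and> h k < gap (x + y)" if "y \<in> S k" for y k
    using that by (simp add: S_iff bad_ring_def dist_norm)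
  \<comment> \<open>A lower bound for the kernel on ring \<open>k\<close>: the gap is replaced by
    the height \<open>h k\<close> and \<open>norm y\<close> by the outer radius.\<close>
  define a where "a k = lam * h k * (2 - \<alpha>) / (r k ^ DIM('a) * r k powr \<alpha>)" for k
  have F_ge: "lam * gap (x + y) * (2 - \<alpha>) / (norm y ^ DIM('a) * norm y powr \<alpha>) \<le> F y"
    if "k < N" "y \<in> S k" for k y
  proof -
    have y: "\<epsilon> \<le> norm y" "norm y < 2" "0 < norm y"
      using SD[OF that(2)] rmono[of "Suc k" N] rmono[of 0 k] rSuc[of k] \<epsilon> \<open>r 0 \<le> 1\<close> \<open>k < N\<close> rpos[of k]
      by auto
    have "lam * gap (x + y) * (2 - \<alpha>) \<le> lam * max 0 (- second_diff u x y) * (2 - \<alpha>)"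
      using gap_le_second_diff[OF y(2)] \<open>0 < lam\<close> \<open>\<alpha> < 2\<close> by (intro mult_left_mono mult_right_mono) auto
    then show ?thesis using y by (simp add: F_def contact_kernel_def divide_right_mono)
  qed
  have h0: "0 \<le> h k" for k using C0 f0 by (simp add: h_def)
  have le: "a k \<le> F y" if "k < N" "y \<in> S k" for k y
  proof -
    have y: "0 < norm y" "norm y < r k" "h k < gap (x + y)" using SD[OF that(2)] rpos[of k] by auto
    have "a k \<le> lam * gap (x + y) * (2 - \<alpha>) / (norm y ^ DIM('a) * norm y powr \<alpha>)"
      unfolding a_def using y h0[of k] \<open>0 < lam\<close> \<open>\<alpha> < 2\<close> \<open>0 < \<alpha>\<close>
      using rpos[of k]
      by (intro frac_le mult_mono power_mono powr_mono2 mult_pos_pos zero_less_power) (auto intro: less_imp_le)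
    also have "\<dots> \<le> F y" by (rule F_ge[OF that])
    finally show ?thesis .
  qed
  have "disjoint_family_on S {..<N}"
    unfolding disjoint_family_on_def
  proof (intro ballI impI)
    fix k l :: nat assume "k \<noteq> l"
    have "S k \<inter> S l = {}" if "k < l" for k l
      using SD[of _ k] SD[of _ l] rmono[of "Suc k" l] rSuc[of k] that by fastforce
    then show "S k \<inter> S l = {}" using \<open>k \<noteq> l\<close> by (cases k l rule: linorder_cases) auto
  qed
  then have "(\<Sum>k<N. a k * measure lebesgue (S k)) \<le> (LINT y|lebesgue. F y)"
    using le Sf F0 Fint(1) by (intro sum_measure_le_integral) auto
  also have "\<dots> \<le> f x" by (rule Fint)
  finally have sum_le: "(\<Sum>k<N. a k * measure lebesgue (S k)) \<le> f x" .
  define A where "A = lam * C * f x / (3 * sqrt ?d) ^ DIM('a)"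
  have A0: "0 \<le> A" using \<open>0 < lam\<close> C0 f0 by (simp add: A_def)
  \<comment> \<open>The volume of the cube cancels the d-th power of the radius. The quadratic
    height leaves \<open>r k powr (2 - \<alpha>)\<close>, geometric in \<open>k\<close>.\<close>
  have term_ge: "A * r 0 powr (2 - \<alpha>) * (2 - \<alpha>) * (2 powr - (2 - \<alpha>)) ^ k \<le> a k * measure lebesgue (S k)"
    if "k < N" for k
  proof -
    define t where "t = s / 2 ^ k"
    have "0 < t" using \<open>0 < s\<close> by (simp add: t_def)
    have rt: "r k = 3 * sqrt ?d * t" by (simp add: rs t_def)
    have "r k powr (2 - \<alpha>) = r 0 powr (2 - \<alpha>) * (2 powr - (2 - \<alpha>)) ^ k"
    proof -
      have "r k = r 0 * 2 powr - real k" by (simp add: rs powr_minus powr_realpow divide_inverse)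
      then have "r k powr (2 - \<alpha>) = r 0 powr (2 - \<alpha>) * (2 powr - real k) powr (2 - \<alpha>)"
        using rpos[of 0] by (simp add: powr_mult)
      also have "(2 powr - real k) powr (2 - \<alpha>) = (2 powr - (2 - \<alpha>)) powr real k"
        unfolding powr_powr by (simp add: algebra_simps)
      also have "\<dots> = (2 powr - (2 - \<alpha>)) ^ k" by (rule powr_realpow) simp
      finally show ?thesis .
    qed
    then have "A * r 0 powr (2 - \<alpha>) * (2 - \<alpha>) * (2 powr - (2 - \<alpha>)) ^ k = A * (2 - \<alpha>) * r k powr (2 - \<alpha>)"
      by simp
    also have "r k powr (2 - \<alpha>) = (r k)\<^sup>2 / r k powr \<alpha>"
      using rpos[of k] by (simp add: powr_diff)
    also have "A * (2 - \<alpha>) * ((r k)\<^sup>2 / r k powr \<alpha>) = a k * t ^ DIM('a)"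
    proof -
      have "r k ^ DIM('a) = (3 * sqrt ?d) ^ DIM('a) * t ^ DIM('a)" by (simp only: rt power_mult_distrib[of _ t])
      then have "a k * t ^ DIM('a) = lam * h k * (2 - \<alpha>) / ((3 * sqrt ?d) ^ DIM('a) * r k powr \<alpha>)"
        using \<open>0 < t\<close> by (simp add: a_def)
      then show ?thesis by (simp add: A_def h_def)
    qed
    also have "\<dots> \<le> a k * measure lebesgue (S k)"
      using bad[OF that] h0[of k] \<open>0 < lam\<close> \<open>\<alpha> < 2\<close> rpos[of k] unfolding measS t_def
      by (intro mult_left_mono) (auto simp: a_def)
    finally show ?thesis .
  qed
  have "f x * 2 = A * (9 / (512 * ?d)) * (1 / 2)"
  proof -
    have "0 < (3 * sqrt ?d) ^ DIM('a)" "0 < ?d" using d by auto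
    then have "A * (9 / (512 * ?d)) * (1 / 2) = (lam * C * 9) * f x / (1024 * ?d * (3 * sqrt ?d) ^ DIM('a))"
      by (simp add: A_def mult_ac)
    also have "\<dots> = f x * 2"
      unfolding C using \<open>0 < (3 * sqrt ?d) ^ DIM('a)\<close> \<open>0 < ?d\<close> by simp
    finally show ?thesis by simp
  qed
  also have "\<dots> \<le> A * r 0 powr (2 - \<alpha>) * ((2 - \<alpha>) * (\<Sum>k<N. (2 powr - (2 - \<alpha>)) ^ k))"
  proof (intro mult_mono mult_left_mono)
    \<comment> \<open>The threshold \<open>2 powr (- 1 / (2 - \<alpha>))\<close> becomes 1/2 under
      the power \<open>2 - \<alpha>\<close>, and \<open>\<rho> \<le> 1\<close> allows the other
      factor to be bounded below by its square. Both bounds are independent of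
      \<open>\<alpha>\<close>.\<close>
    show "9 / (512 * ?d) \<le> r 0 powr (2 - \<alpha>)"
    proof -
      define \<rho> where "\<rho> = 3 / (16 * sqrt ?d)"
      have "0 < \<rho>" using d by (simp add: \<rho>_def)
      have "\<rho> \<le> 1" using rho_le by (simp add: \<rho>_def)
      have "9 / (512 * ?d) = \<rho> powr 2 * (1 / 2)"
        using \<open>0 < \<rho>\<close> d by (simp add: \<rho>_def power2_eq_square field_simps)
      also have "\<dots> \<le> \<rho> powr (2 - \<alpha>) * (1 / 2)"
        using \<open>0 < \<rho>\<close> \<open>\<rho> \<le> 1\<close> \<open>0 < \<alpha>\<close> by (intro mult_right_mono powr_mono') auto
      also have "(1 / 2 :: real) = (2 powr (- 1 / (2 - \<alpha>))) powr (2 - \<alpha>)"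
      proof -
        have "- 1 / (2 - \<alpha>) * (2 - \<alpha>) = - 1" using \<open>\<alpha> < 2\<close> by simp
        then show ?thesis by (simp only: powr_powr) (simp add: powr_minus)
      qed
      also have "\<rho> powr (2 - \<alpha>) * \<dots> = r 0 powr (2 - \<alpha>)"
        unfolding r0 \<rho>_def[symmetric] by (rule powr_mult[symmetric])
      finally show ?thesis .
    qed
    show "1 / 2 \<le> (2 - \<alpha>) * (\<Sum>k<N. (2 powr - (2 - \<alpha>)) ^ k)"
      using geometric_sum_ge[of "2 - \<alpha>" N] N \<open>\<alpha> < 2\<close> by simp
  qed (use A0 in auto)
  also have "\<dots> = (\<Sum>k<N. A * r 0 powr (2 - \<alpha>) * (2 - \<alpha>) * (2 powr - (2 - \<alpha>)) ^ k)"
    by (simp add: sum_distrib_left mult.assoc)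
  also have "\<dots> \<le> (\<Sum>k<N. a k * measure lebesgue (S k))"
    using term_ge by (intro sum_mono) auto
  also note sum_le
  \<comment> \<open>From \<open>2 * f x \<le> f x\<close>. Ring 0 settles this degenerate case: the
    heights are 0, so the kernel is positive on a set of positive measure although its integral is
    0.\<close>
  finally have "f x = 0" using f0 by simp
  have "(LINT y|lebesgue. F y) = 0"
    using Fint(2) Fint0 \<open>f x = 0\<close> by linarith
  then have "AE y in lebesgue. F y = 0"
    using integral_nonneg_eq_0_iff_AE[of lebesgue F] Fint(1) F0 by simp
  then have "AE y in lebesgue. y \<notin> S 0"
  proof (rule AE_mp, intro AE_I2 impI notI)
    fix y assume y: "F y = 0" "y \<in> S 0"
    have "0 < gap (x + y)" "0 < norm y" using SD[OF y(2)] h0[of 0] rpos[of 0] by auto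
    then have "0 < lam * gap (x + y) * (2 - \<alpha>) / (norm y ^ DIM('a) * norm y powr \<alpha>)"
      using \<open>0 < lam\<close> \<open>\<alpha> < 2\<close> by simp
    then show False using F_ge[OF N0 y(2)] y(1) by linarith
  qed
  then have "measure lebesgue (S 0) = 0"
    using Sf[of 0] by (simp add: AE_iff_null_sets[symmetric] measure_eq_0_null_sets fmeasurableD)
  moreover have "0 < (s / 2 ^ 0) ^ DIM('a)" using \<open>0 < s\<close> by (intro zero_less_power) simp
  ultimately show False using bad[OF N0] measS[of 0] by linarith
qed

end

section \<open>Envelope, gradient and density estimates from a good ring\<close>

lemma ball_Int_ball_opposite:
  fixes x e :: "'a::euclidean_space"
  assumes "norm e = 3 / 4 * r" "0 < r"
  shows "ball (x + e) (r / 4) \<inter> ball (x - e) (r / 4) = {}"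
proof -
  have "norm ((x + e) - (x - e)) = 2 * norm e" by (simp flip: scaleR_2)
  then have "r / 4 + r / 4 \<le> dist (x + e) (x - e)" using assms by (simp add: dist_norm)
  then show ?thesis by (rule disjoint_ballI)
qed

lemma ball_shift_subset_ring:
  fixes x e :: "'a::euclidean_space"
  assumes "norm e = 3 / 4 * r"
  shows "ball (x + e) (r / 4) \<subseteq> {z. r / 2 \<le> dist x z \<and> dist x z < r}"
proof
  fix y assume "y \<in> ball (x + e) (r / 4)"
  then have "norm (x + e - y) < r / 4" by (simp add: dist_norm)
  moreover have "norm e \<le> norm (x + e - y) + norm (y - x)" "norm (y - x) \<le> norm e + norm (x + e - y)"
    using norm_triangle_ineq[of "x + e - y" "y - x"] norm_triangle_ineq4[of e "x + e - y"]
    by (simp_all add: algebra_simps)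
  ultimately show "y \<in> {z. r / 2 \<le> dist x z \<and> dist x z < r}"
    using assms by (simp add: dist_norm norm_minus_commute)
qed

context contact_point begin

text \<open>If the envelope were lower somewhere in the half ball, a ball of radius
  \<open>r / 4\<close> in the ring would be bad because \<open>u\<close> is below the envelope.
  Since \<open>r / 4\<close> exceeds the half diagonal of a cube of side \<open>s\<close>, that is
  too much volume.\<close>

lemma good_ring_envelope:
  assumes meas: "u \<in> borel_measurable lebesgue" and s: "0 < s" and r: "r = 3 * sqrt DIM('a) * s" "r \<le> 1"
    and good: "measure lebesgue (bad_ring r h) < s ^ DIM('a)" and z: "z \<in> ball x (r / 2)"
  shows "u x + b \<bullet> (z - x) - h \<le> concave_envelope u z"
proof (rule ccontr)
  assume "\<not> ?thesis"
  then have less: "concave_envelope u z < u x + b \<bullet> (z - x) - h" by simp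
  have sub: "ball x r \<subseteq> ball 0 3"
  proof
    fix y assume "y \<in> ball x r"
    then show "y \<in> ball 0 3"
      using norm_triangle_ineq[of x "y - x"] x_ball r by (simp add: dist_norm norm_minus_commute)
  qed
  have "concave_on (ball x r) (concave_envelope u)"
    using concave_on_concave_envelope[OF bounded] sub unfolding concave_on_def
    by (rule convex_on_subset) simp
  then obtain e where e: "norm e = 3 / 4 * r"
    "\<And>y. y \<in> ball (x + e) (r / 4) \<Longrightarrow> concave_envelope u y < u x + b \<bullet> (y - x) - h"
    using concave_ring_ball[where g = "concave_envelope u" and p = "u x" and b = b and h = h, OF _ z less] by blast
  have "ball (x + e) (r / 4) \<subseteq> bad_ring r h"
  proof
    fix y assume y: "y \<in> ball (x + e) (r / 4)"
    then have ring: "r / 2 \<le> dist x y \<and> dist x y < r" using ball_shift_subset_ring[OF e(1)] by blast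
    then have "u y \<le> concave_envelope u y" using sub by (intro u_le_envelope) auto
    then show "y \<in> bad_ring r h" using e(2)[OF y] ring by (simp add: bad_ring_def gap_def)
  qed
  then have "measure lebesgue (ball (x + e) (r / 4)) \<le> measure lebesgue (bad_ring r h)"
    by (intro measure_mono_fmeasurable bad_ring_fmeasurable meas) auto
  moreover have "s ^ DIM('a) \<le> measure lebesgue (ball (x + e) (r / 4))"
    using s r by (intro measure_ball_ge) auto
  ultimately show False using good by simp
qed

text \<open>The cube has diameter \<open>r / 3\<close>, and 1/3 + 1/7 < 1/2, so from each of its
  points a step of length \<open>r / 7\<close> stays in the half ball where the envelope is within
  \<open>h\<close> of the plane.\<close>

lemma grad_envelope_subset_cball:
  assumes meas: "u \<in> borel_measurable lebesgue" and s: "0 < s" and r: "r = 3 * sqrt DIM('a) * s" "r \<le> 1"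
    and good: "measure lebesgue (bad_ring r h) < s ^ DIM('a)"
    and x: "x \<in> closure (open_cube c s)"
  shows "grad_envelope u (closure (open_cube c s)) \<subseteq> cball b (7 * h / r)"
proof
  have "0 < r" using s r by simp
  fix b' assume "b' \<in> grad_envelope u (closure (open_cube c s))"
  then obtain y where y: "y \<in> closure (open_cube c s)"
    "b' \<in> superdifferential (ball 0 3) (concave_envelope u) y" by (auto simp: grad_envelope_def)
  have "dist x y \<le> diameter (closure (open_cube c s))"
    using x y(1) by (intro diameter_bounded_bound) (simp_all add: closure_open_cube[OF s])
  also have "\<dots> = r / 3"
    using diameter_open_cube[OF s, of c] by (simp add: diameter_closure open_cube_def r)
  finally have "dist x y + r / 7 < r / 2" using \<open>0 < r\<close> by simp
  moreover have sub: "ball x (r / 2) \<subseteq> ball 0 3"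
  proof
    fix y assume "y \<in> ball x (r / 2)"
    then show "y \<in> ball 0 3"
      using norm_triangle_ineq[of x "y - x"] x_ball r \<open>0 < r\<close> by (simp add: dist_norm norm_minus_commute)
  qed
  ultimately have "norm (b' - b) \<le> h / (r / 7)"
    using good_ring_envelope[OF meas s r good] envelope_le_plane y(2) \<open>0 < r\<close>
    by (intro superdifferential_near[of x "r / 2" "concave_envelope u" "u x" b "r / 2" h "ball 0 3" "r / 7" y b']) auto
  then show "b' \<in> cball b (7 * h / r)" by (simp add: dist_norm norm_minus_commute mult.commute)
qed

text \<open>The ring contains two disjoint balls, each at least as large as the cube, and the bad
  set uses up less than one cube. The superset \<open>S\<close> lets the strict and the non-strict
  density estimate share this proof.\<close>

lemma good_ring_measure:
  assumes meas: "u \<in> borel_measurable lebesgue" and s: "0 < s" and r: "r = 3 * sqrt DIM('a) * s" "r \<le> 1"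
    and good: "measure lebesgue (bad_ring r h) < s ^ DIM('a)"
    and x: "x \<in> closure (open_cube c s)"
    and S: "{y \<in> open_cube c (8 * sqrt DIM('a) * s). concave_envelope u y - h \<le> u y} \<subseteq> S"
    "S \<in> fmeasurable lebesgue"
  shows "s ^ DIM('a) \<le> measure lebesgue S"
proof -
  let ?R = "{z. r / 2 \<le> dist x z \<and> dist x z < r}"
  have "0 < r" using s r by simp
  obtain a :: 'a where "a \<in> Basis" using nonempty_Basis by blast
  define e where "e = (3 / 4 * r) *\<^sub>R a"
  have e: "norm e = 3 / 4 * r" "norm (- e) = 3 / 4 * r"
    using \<open>a \<in> Basis\<close> \<open>0 < r\<close> by (auto simp: e_def)
  have "s ^ DIM('a) + s ^ DIM('a) \<le> measure lebesgue (ball (x + e) (r / 4)) + measure lebesgue (ball (x - e) (r / 4))"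
    using s r by (intro add_mono measure_ball_ge) auto
  also have "\<dots> = measure lebesgue (ball (x + e) (r / 4) \<union> ball (x - e) (r / 4))"
    using ball_Int_ball_opposite[OF e(1) \<open>0 < r\<close>, of x] by (subst measure_Un3) auto
  also have "\<dots> \<le> measure lebesgue ?R"
    using ball_shift_subset_ring[OF e(1), of x] ball_shift_subset_ring[OF e(2), of x]
    by (intro measure_mono_fmeasurable ring_fmeasurable) auto
  also have "\<dots> = measure lebesgue (bad_ring r h) + measure lebesgue (?R - bad_ring r h)"
    using bad_ring_fmeasurable[OF meas, of r h] ring_fmeasurable[of r]
    by (subst measurable_measure_Diff) (auto simp: bad_ring_def fmeasurableD)
  also have "\<dots> \<le> s ^ DIM('a) + measure lebesgue (?R - bad_ring r h)" using good by simp
  also have "measure lebesgue (?R - bad_ring r h) \<le> measure lebesgue S"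
  proof (intro measure_mono_fmeasurable order_trans[OF _ S(1)] S(2) subsetI)
    show "?R - bad_ring r h \<in> sets lebesgue"
      using bad_ring_fmeasurable[OF meas, of r h] ring_fmeasurable[of r] by (auto simp: fmeasurableD)
    fix y assume y: "y \<in> ?R - bad_ring r h"
    then have "norm (y - x) < r" by (simp add: dist_norm norm_minus_commute)
    then have y3: "y \<in> ball 0 3" using norm_triangle_ineq[of x "y - x"] x_ball r by simp
    have "gap y \<le> h" using y by (auto simp: bad_ring_def)
    then have "concave_envelope u y - h \<le> u y" using envelope_le_plane[OF y3] by (simp add: gap_def)
    moreover have "y \<in> open_cube c (8 * sqrt DIM('a) * s)"
      unfolding mem_open_cube
    proof
      fix i :: 'a assume i: "i \<in> Basis"
      have "\<bar>(y - x) \<bullet> i\<bar> < r" using Basis_le_norm[OF i, of "y - x"] \<open>norm (y - x) < r\<close> by simp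
      moreover have "c \<bullet> i - s / 2 \<le> x \<bullet> i \<and> x \<bullet> i \<le> c \<bullet> i + s / 2"
        using x i by (simp add: mem_closure_open_cube[OF s])
      \<comment> \<open>Thus \<open>s / 2 + r\<close> is less than half the side of the dilated
        cube, which is \<open>4 * sqrt DIM('a) * s\<close>.\<close>
      moreover have "s \<le> sqrt DIM('a) * s"
        using s by (simp add: Suc_leI)
      ultimately show "c \<bullet> i - 8 * sqrt DIM('a) * s / 2 < y \<bullet> i \<and> y \<bullet> i < c \<bullet> i + 8 * sqrt DIM('a) * s / 2"
        using r(1) s unfolding inner_diff_left by linarith
    qed
    ultimately show "y \<in> {y \<in> open_cube c (8 * sqrt DIM('a) * s). concave_envelope u y - h \<le> u y}" by simp
  qed
  finally show ?thesis by simp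
qed

end

section \<open>The covering\<close>

context contact_point begin

text \<open>The factor 42 is \<open>2 * 7 * 3\<close>: the gradients lie in a ball of radius \<open>7 * h / r\<close>, which fits into a
  cube of twice that side, and \<open>r\<close> is three times the diameter of the cube.\<close>

lemma good_cube:
  fixes C0 C s r :: real and c :: 'a and f :: "'a \<Rightarrow> real"
  defines "d \<equiv> sqrt DIM('a) * s"
    and "M \<equiv> sup_over (closure (open_cube c s)) f"
    and "dilQ \<equiv> open_cube c (8 * sqrt DIM('a) * s)"
  assumes meas: "u \<in> borel_measurable lebesgue" and s: "0 < s" and r: "r = 3 * sqrt DIM('a) * s" "r \<le> 1"
    and C0: "0 < C0" and f: "0 \<le> f x" and C: "C = (42 * sqrt DIM('a) * C0) ^ DIM('a) + 9 * C0 + 1"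
    and good: "measure lebesgue (bad_ring r (C0 * f x * r\<^sup>2)) < s ^ DIM('a)"
    and x: "x \<in> closure (open_cube c s)"
  shows "enn2ereal (emeasure lebesgue (grad_envelope u (closure (open_cube c s))))
      \<le> ereal C * M ^ DIM('a) * ereal (s ^ DIM('a))"
    and "M \<noteq> 0 \<Longrightarrow> s ^ DIM('a) \<le> measure lebesgue
      {y \<in> dilQ. ereal (concave_envelope u y) - ereal C * M * ereal (d\<^sup>2) < ereal (u y)}"
    and "s ^ DIM('a) \<le> measure lebesgue
      {y \<in> dilQ. ereal (concave_envelope u y) - ereal C * M * ereal (d\<^sup>2) \<le> ereal (u y)}"
proof -
  define h where "h = C0 * f x * r\<^sup>2"
  define k where "k = ereal C * M * ereal (d\<^sup>2)"
  have "0 < r" "0 < d" using s r by (simp_all add: d_def)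
  have A0: "0 \<le> (42 * sqrt DIM('a) * C0) ^ DIM('a)" using C0 by simp
  then have Cpos: "0 < C" using C0 unfolding C by linarith
  have fM: "ereal (f x) \<le> M" unfolding M_def sup_over_def using x by (rule SUP_upper)
  have hd: "h = 9 * C0 * f x * d\<^sup>2" by (simp add: h_def r d_def power_mult_distrib)
  \<comment> \<open>As \<open>0 \<le> f x \<le> M\<close>, a nonzero \<open>M\<close> is positive,
    and the summand 1 in \<open>C\<close> makes the comparison strict. For \<open>M = 0\<close> only
    the weak inequality is available, hence the two density estimates.\<close>
  have hk: "ereal h \<le> k \<and> (M \<noteq> 0 \<longrightarrow> ereal h < k)"
  proof (cases M)
    case (real m)
    then have m: "f x \<le> m" using fM by simp
    have k: "k = ereal (C * m * d\<^sup>2)" by (simp add: k_def real)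
    have le: "h \<le> 9 * C0 * m * d\<^sup>2" unfolding hd using m C0 by (intro mult_right_mono mult_left_mono) auto
    have "9 * C0 * m * d\<^sup>2 \<le> C * m * d\<^sup>2" using A0 C m f by (intro mult_right_mono) auto
    moreover have "9 * C0 * m * d\<^sup>2 < C * m * d\<^sup>2" if "M \<noteq> 0"
      using A0 C m f real that \<open>0 < d\<close> by (intro mult_strict_right_mono) auto
    ultimately show ?thesis using le k by force
  next
    case PInf
    then have "k = \<infinity>" using Cpos \<open>0 < d\<close> by (simp add: k_def)
    then show ?thesis by simp
  qed (use fM in auto)
  have env[measurable]: "concave_envelope u \<in> borel_measurable lebesgue"
    by (rule concave_envelope_measurable[OF bounded])
  note [measurable] = meas
  have dil: "dilQ \<in> fmeasurable lebesgue" by (simp add: dilQ_def open_cube_def)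
  have "{y \<in> space lebesgue. ereal (concave_envelope u y) - k < ereal (u y)} \<in> sets lebesgue"
    "{y \<in> space lebesgue. ereal (concave_envelope u y) - k \<le> ereal (u y)} \<in> sets lebesgue" by measurable
  then have "dilQ \<inter> {y \<in> space lebesgue. ereal (concave_envelope u y) - k < ereal (u y)} \<in> fmeasurable lebesgue"
    "dilQ \<inter> {y \<in> space lebesgue. ereal (concave_envelope u y) - k \<le> ereal (u y)} \<in> fmeasurable lebesgue"
    using dil by (auto intro: fmeasurable_Int_fmeasurable)
  then have S: "{y \<in> dilQ. ereal (concave_envelope u y) - k < ereal (u y)} \<in> fmeasurable lebesgue"
    "{y \<in> dilQ. ereal (concave_envelope u y) - k \<le> ereal (u y)} \<in> fmeasurable lebesgue"
    by (simp_all add: Int_def)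
  note good = good[folded h_def]
  have le: "ereal g - k \<le> ereal v" if "g - h \<le> v" for g v
    using hk that by (cases k) auto
  have less: "ereal g - k < ereal v" if "g - h \<le> v" "M \<noteq> 0" for g v
    using hk that by (cases k) auto
  show "s ^ DIM('a) \<le> measure lebesgue {y \<in> dilQ. ereal (concave_envelope u y) - k < ereal (u y)}"
    if "M \<noteq> 0"
    using less that by (intro good_ring_measure[OF meas s r good x _ S(1)]) (auto simp: dilQ_def)
  show "s ^ DIM('a) \<le> measure lebesgue {y \<in> dilQ. ereal (concave_envelope u y) - k \<le> ereal (u y)}"
    using le by (intro good_ring_measure[OF meas s r good x _ S(2)]) (auto simp: dilQ_def)
  have "emeasure lebesgue (grad_envelope u (closure (open_cube c s))) \<le> emeasure lebesgue (cball b (7 * h / r))"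
    by (intro emeasure_mono grad_envelope_subset_cball[OF meas s r good x]) simp
  also have "\<dots> \<le> ennreal ((2 * (7 * h / r)) ^ DIM('a))"
    \<comment> \<open>The radius may be 0, namely when \<open>f x = 0\<close>, so closed balls are
      used.\<close>
    using C0 f \<open>0 < r\<close> by (intro emeasure_cball_le) (simp add: h_def)
  also have "2 * (7 * h / r) = 42 * sqrt DIM('a) * C0 * f x * s"
    using \<open>0 < r\<close> by (simp add: h_def power2_eq_square) (simp add: r)
  finally have "emeasure lebesgue (grad_envelope u (closure (open_cube c s)))
      \<le> ennreal ((42 * sqrt DIM('a) * C0 * f x * s) ^ DIM('a))" .
  then have "enn2ereal (emeasure lebesgue (grad_envelope u (closure (open_cube c s))))
      \<le> enn2ereal (ennreal ((42 * sqrt DIM('a) * C0 * f x * s) ^ DIM('a)))"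
    by (simp only: less_eq_ennreal.rep_eq)
  also have "\<dots> = ereal ((42 * sqrt DIM('a) * C0) ^ DIM('a) * f x ^ DIM('a) * s ^ DIM('a))"
    using C0 f s by (subst enn2ereal_ennreal) (simp_all only: power_mult_distrib, simp)
  also have "\<dots> \<le> ereal C * M ^ DIM('a) * ereal (s ^ DIM('a))"
  proof (cases M)
    case (real m)
    then have "f x \<le> m" using fM by simp
    then have "(42 * sqrt DIM('a) * C0) ^ DIM('a) * f x ^ DIM('a) * s ^ DIM('a) \<le> C * m ^ DIM('a) * s ^ DIM('a)"
      using f s C0 A0 Cpos C by (intro mult_right_mono mult_mono power_mono) auto
    then show ?thesis by (simp add: real)
  next
    case PInf
    then show ?thesis using Cpos s by simp
  qed (use fM in auto)
  finally show "enn2ereal (emeasure lebesgue (grad_envelope u (closure (open_cube c s))))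
      \<le> ereal C * M ^ DIM('a) * ereal (s ^ DIM('a))" .
qed

end

section \<open>Choice of constants and assembly of the covering\<close>

theorem theorem3p1:
  fixes lam :: real
  assumes "0 < lam"
  shows "\<exists>C>0. \<exists>\<mu>>0.
    \<forall>Lam \<beta> \<alpha> \<kappa> \<phi> (i::nat) (u :: 'a::euclidean_space \<Rightarrow> real) (f :: 'a \<Rightarrow> real).
      lam \<le> Lam \<and> 0 < \<beta> \<and> \<beta> < 2 \<and> \<beta> < \<alpha> \<and> \<alpha> < 2 \<and>
      admissible_weight \<kappa> \<beta> \<phi> \<and>
      u \<in> borel_measurable lebesgue \<and>
      (\<forall>x. x \<notin> ball 0 1 \<longrightarrow> u x \<le> 0) \<and>
      viscosity_subsolution (Mplus lam Lam \<kappa> \<beta> \<alpha> \<phi> i) (ball 0 1) (\<lambda>x. - f x) u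
      \<longrightarrow>
      (\<exists>(m::nat) (c :: nat \<Rightarrow> 'a) (s :: nat \<Rightarrow> real).
        (let Q = (\<lambda>j. open_cube (c j) (s j));
             dm = (\<lambda>j. diameter (Q j));
             M = (\<lambda>j. sup_over (closure (Q j)) f);
             \<Gamma> = concave_envelope u;
             \<Sigma> = contact_set u;
             \<rho>0 = 1 / (16 * sqrt (real DIM('a)));
             dilQ = (\<lambda>j. open_cube (c j) (8 * sqrt (real DIM('a)) * s j))
         in
          (\<forall>j\<in>{1..m}. 0 < s j) \<and>
          (\<forall>j\<in>{1..m}. \<forall>l\<in>{1..m}. j \<noteq> l \<longrightarrow> Q j \<inter> Q l = {}) \<and>
          \<Sigma> \<subseteq> (\<Union>j\<in>{1..m}. closure (Q j)) \<and>
          (\<forall>j\<in>{1..m}.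
             \<Sigma> \<inter> closure (Q j) \<noteq> {} \<and>
             dm j \<le> \<rho>0 * 2 powr (- 1 / (2 - \<alpha>)) \<and>
             enn2ereal (emeasure lebesgue (grad_envelope u (closure (Q j))))
               \<le> ereal C * M j ^ DIM('a) * ereal (measure lebesgue (closure (Q j))) \<and>
             (M j \<noteq> 0 \<longrightarrow>
               \<mu> * measure lebesgue (Q j) \<le>
               measure lebesgue
                 {y \<in> dilQ j. ereal (\<Gamma> y) - ereal C * M j * ereal ((dm j)\<^sup>2) < ereal (u y)}) \<and>
             \<mu> * measure lebesgue (Q j) \<le>
               measure lebesgue
                 {y \<in> dilQ j. ereal (\<Gamma> y) - ereal C * M j * ereal ((dm j)\<^sup>2) \<le> ereal (u y)})))"
proof -
  let ?d = "real DIM('a)"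
  have d: "1 \<le> ?d" using DIM_positive[where 'a='a] by linarith
  \<comment> \<open>Solves the equation for the height constant of the rings. Like \<open>C\<close>,
    it depends on \<open>lam\<close> and the dimension only; the density constant is 1.\<close>
  define C0 where "C0 = 2048 * ?d * (3 * sqrt ?d) ^ DIM('a) / (9 * lam)"
  define C where "C = (42 * sqrt ?d * C0) ^ DIM('a) + 9 * C0 + 1"
  have C0: "0 < C0" "lam * C0 * 9 = 2048 * ?d * (3 * sqrt ?d) ^ DIM('a)" using d assms by (simp_all add: C0_def)
  have "0 < C" using C0(1) d unfolding C_def by (intro add_nonneg_pos add_nonneg_nonneg) auto
  show ?thesis
  proof (rule exI[of _ C], rule conjI[OF \<open>0 < C\<close>], rule exI[of _ 1], rule conjI[OF zero_less_one],
      intro allI impI)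
    fix Lam \<beta> \<alpha> \<kappa> :: real and \<phi> :: "real \<Rightarrow> real" and i :: nat
      and u :: "'a \<Rightarrow> real" and f :: "'a \<Rightarrow> real"
    assume "lam \<le> Lam \<and> 0 < \<beta> \<and> \<beta> < 2 \<and> \<beta> < \<alpha> \<and> \<alpha> < 2 \<and>
      admissible_weight \<kappa> \<beta> \<phi> \<and>
      u \<in> borel_measurable lebesgue \<and>
      (\<forall>x. x \<notin> ball 0 1 \<longrightarrow> u x \<le> 0) \<and>
      viscosity_subsolution (Mplus lam Lam \<kappa> \<beta> \<alpha> \<phi> i) (ball 0 1) (\<lambda>x. - f x) u"
    then have \<alpha>: "0 < \<alpha>" "\<alpha> < 2" and meas: "u \<in> borel_measurable lebesgue"
      and nonpos: "\<And>x. x \<notin> ball 0 1 \<Longrightarrow> u x \<le> 0"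
      and visc: "viscosity_subsolution (Mplus lam Lam \<kappa> \<beta> \<alpha> \<phi> i) (ball 0 1) (\<lambda>x. - f x) u"
      by auto
    have bounded: "bounded (range u)" using visc by (simp add: viscosity_subsolution_def)
    \<comment> \<open>Cubes of side \<open>s\<close> have exactly the largest permitted
      diameter.\<close>
    define s where "s = 1 / (16 * sqrt ?d) * 2 powr (- 1 / (2 - \<alpha>)) / sqrt ?d"
    have "0 < s" using d by (simp add: s_def)
    \<comment> \<open>All requirements on a single cube, to be used as the stopping criterion of the
      tiling.\<close>
    define good where "good c t \<longleftrightarrow>
      contact_set u \<inter> closure (open_cube c t) \<noteq> {} \<and>
      diameter (open_cube c t) \<le> 1 / (16 * sqrt ?d) * 2 powr (- 1 / (2 - \<alpha>)) \<and>
      enn2ereal (emeasure lebesgue (grad_envelope u (closure (open_cube c t))))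
        \<le> ereal C * sup_over (closure (open_cube c t)) f ^ DIM('a) * ereal (measure lebesgue (closure (open_cube c t))) \<and>
      (sup_over (closure (open_cube c t)) f \<noteq> 0 \<longrightarrow>
        1 * measure lebesgue (open_cube c t) \<le> measure lebesgue
          {y \<in> open_cube c (8 * sqrt ?d * t). ereal (concave_envelope u y) -
            ereal C * sup_over (closure (open_cube c t)) f * ereal ((diameter (open_cube c t))\<^sup>2) < ereal (u y)}) \<and>
      1 * measure lebesgue (open_cube c t) \<le> measure lebesgue
          {y \<in> open_cube c (8 * sqrt ?d * t). ereal (concave_envelope u y) -
            ereal C * sup_over (closure (open_cube c t)) f * ereal ((diameter (open_cube c t))\<^sup>2) \<le> ereal (u y)}"
      for c t
    have "(2::real) powr - (2 - \<alpha>) < 1" using \<alpha> by (simp add: powr_less_one)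
    then obtain N where "(2 powr - (2 - \<alpha>)) ^ N < (1 / 2 :: real)"
      using real_arch_pow_inv[of "1 / 2"] by auto
    then have N: "(2 powr - (2 - \<alpha>)) ^ N \<le> (1 / 2 :: real)" by simp
    have scale: "\<exists>k<N. \<forall>c. x \<in> closure (open_cube c (s / 2 ^ k)) \<longrightarrow> good c (s / 2 ^ k)"
      if x: "x \<in> contact_set u" for x
    proof -
      have "x \<in> ball 0 1" using x by (simp add: contact_set_def)
      then obtain b where "b \<in> superdifferential (ball 0 3) (concave_envelope u) x"
        using superdifferential_nonempty[OF bounded] by blast
      then interpret contact_point u x b using bounded nonpos x by unfold_locales
      define r where "r k = 3 * sqrt DIM('a) * (s / 2 ^ k)" for k :: nat
      have r0: "r 0 = 3 / (16 * sqrt DIM('a)) * 2 powr (- 1 / (2 - \<alpha>))"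
        using d by (simp add: r_def s_def)
      obtain k where k: "k < N" "measure lebesgue (bad_ring (r k) (C0 * f x * (r k)\<^sup>2)) < (s / 2 ^ k) ^ DIM('a)"
        using exists_good_scale[OF meas assms \<alpha> visc \<open>0 < s\<close> r_def r0 N C0(2)] by blast
      define t where "t = s / 2 ^ k"
      have t: "0 < t" "t \<le> s" using \<open>0 < s\<close> by (simp_all add: t_def divide_le_eq)
      have rt: "r k = 3 * sqrt DIM('a) * t" by (simp add: r_def t_def)
      have "r k \<le> r 0" using t d unfolding rt by (simp add: r_def)
      then have r_le: "r k \<le> 1" using initial_radius_le_1[OF d \<alpha>(2)] unfolding r0 by (rule order_trans)
      have f_nonneg: "0 \<le> f x" by (rule contact_rhs_nonneg[OF meas assms \<alpha> visc])
      have ds: "sqrt ?d * s = 1 / (16 * sqrt ?d) * 2 powr (- 1 / (2 - \<alpha>))" using d by (simp add: s_def)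
      have dt: "sqrt ?d * t \<le> 1 / (16 * sqrt ?d) * 2 powr (- 1 / (2 - \<alpha>))"
        unfolding ds[symmetric] using t d by (intro mult_left_mono) auto
      show ?thesis
      proof (intro exI[of _ k] conjI allI impI)
        fix c assume xc: "x \<in> closure (open_cube c (s / 2 ^ k))"
        note gc = good_cube[where f = f, OF meas t(1) rt r_le C0(1) f_nonneg C_def k(2)[folded t_def] xc[folded t_def]]
        show "good c (s / 2 ^ k)"
          unfolding good_def t_def[symmetric] measure_open_cube[OF t(1)] diameter_open_cube[OF t(1)]
          using gc x xc dt by (auto simp: t_def)
      qed (rule k)
    qed
    \<comment> \<open>The tiling starts from a cube of side \<open>s * 2 ^ K \<ge> 2\<close>, large
      enough to contain the unit ball; side \<open>s\<close> is reached after \<open>K\<close>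
      halvings, which shifts all levels by \<open>K\<close>.\<close>
    obtain K where "2 / s < 2 ^ K" using real_arch_pow[of 2 "2 / s"] by auto
    then have K: "2 \<le> s * 2 ^ K" using \<open>0 < s\<close> by (simp add: field_simps)
    have "\<exists>k<K + N. \<forall>c'. x \<in> closure (open_cube c' (s * 2 ^ K / 2 ^ k)) \<longrightarrow> good c' (s * 2 ^ K / 2 ^ k)"
      if "x \<in> contact_set u" for x
    proof -
      obtain k where "k < N" "\<forall>c. x \<in> closure (open_cube c (s / 2 ^ k)) \<longrightarrow> good c (s / 2 ^ k)"
        using scale[OF \<open>x \<in> contact_set u\<close>] by blast
      then show ?thesis by (intro exI[of _ "K + k"]) (simp add: power_add)
    qed
    then obtain T where T: "finite T"
      "\<forall>p\<in>T. 0 < snd p \<and> open_cube (fst p) (snd p) \<subseteq> open_cube 0 (s * 2 ^ K) \<and> good (fst p) (snd p)"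
      "\<forall>p\<in>T. \<forall>q\<in>T. p \<noteq> q \<longrightarrow> open_cube (fst p) (snd p) \<inter> open_cube (fst q) (snd q) = {}"
      "contact_set u \<inter> closure (open_cube 0 (s * 2 ^ K)) \<subseteq> (\<Union>p\<in>T. closure (open_cube (fst p) (snd p)))"
      using dyadic_tiling[of "s * 2 ^ K" "contact_set u" 0 "K + N" good] \<open>0 < s\<close> by auto
    have "contact_set u \<subseteq> closure (open_cube 0 (s * 2 ^ K))"
    proof -
      have "contact_set u \<subseteq> open_cube 0 (2 * 1)"
        using ball_subset_open_cube[of 0 1] by (auto simp: contact_set_def)
      also have "\<dots> \<subseteq> open_cube 0 (s * 2 ^ K)" using K by (force simp: mem_open_cube)
      also have "\<dots> \<subseteq> closure (open_cube 0 (s * 2 ^ K))" by (rule closure_subset)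
      finally show ?thesis .
    qed
    then have cover: "contact_set u \<subseteq> (\<Union>p\<in>T. closure (open_cube (fst p) (snd p)))" using T(4) by blast
    obtain g where g: "bij_betw g {1..card T} T" using ex_bij_betw_nat_finite_1[OF T(1)] by blast
    then have gT: "g j \<in> T" if "j \<in> {1..card T}" for j using that by (rule bij_betwE[THEN bspec])
    have goodT: "good (fst (g j)) (snd (g j))" if "j \<in> {1..card T}" for j
      using T(2) gT[OF that] by blast
    show "\<exists>(m::nat) (c :: nat \<Rightarrow> 'a) (s :: nat \<Rightarrow> real). let Q = \<lambda>j. open_cube (c j) (s j); dm = \<lambda>j. diameter (Q j);
        M = \<lambda>j. sup_over (closure (Q j)) f; \<Gamma> = concave_envelope u; \<Sigma> = contact_set u;
        \<rho>0 = 1 / (16 * sqrt ?d); dilQ = \<lambda>j. open_cube (c j) (8 * sqrt ?d * s j)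
      in (\<forall>j\<in>{1..m}. 0 < s j) \<and>
         (\<forall>j\<in>{1..m}. \<forall>l\<in>{1..m}. j \<noteq> l \<longrightarrow> Q j \<inter> Q l = {}) \<and>
         \<Sigma> \<subseteq> (\<Union>j\<in>{1..m}. closure (Q j)) \<and>
         (\<forall>j\<in>{1..m}. \<Sigma> \<inter> closure (Q j) \<noteq> {} \<and>
           dm j \<le> \<rho>0 * 2 powr (- 1 / (2 - \<alpha>)) \<and>
           enn2ereal (emeasure lebesgue (grad_envelope u (closure (Q j))))
             \<le> ereal C * M j ^ DIM('a) * ereal (measure lebesgue (closure (Q j))) \<and>
           (M j \<noteq> 0 \<longrightarrow> 1 * measure lebesgue (Q j) \<le> measure lebesgue
             {y \<in> dilQ j. ereal (\<Gamma> y) - ereal C * M j * ereal ((dm j)\<^sup>2) < ereal (u y)}) \<and>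
           1 * measure lebesgue (Q j) \<le> measure lebesgue
             {y \<in> dilQ j. ereal (\<Gamma> y) - ereal C * M j * ereal ((dm j)\<^sup>2) \<le> ereal (u y)})"
      unfolding Let_def
    proof (rule exI[of _ "card T"], rule exI[of _ "\<lambda>j. fst (g j)"], rule exI[of _ "\<lambda>j. snd (g j)"],
        intro conjI)
      show "\<forall>j\<in>{1..card T}. 0 < snd (g j)" using T(2) gT by blast
      show "\<forall>j\<in>{1..card T}. \<forall>l\<in>{1..card T}. j \<noteq> l \<longrightarrow>
          open_cube (fst (g j)) (snd (g j)) \<inter> open_cube (fst (g l)) (snd (g l)) = {}"
      proof (intro ballI impI)
        fix j l assume jl: "j \<in> {1..card T}" "l \<in> {1..card T}" "j \<noteq> l"
        then have "g j \<noteq> g l" using inj_onD[OF bij_betw_imp_inj_on[OF g]] by blast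
        then show "open_cube (fst (g j)) (snd (g j)) \<inter> open_cube (fst (g l)) (snd (g l)) = {}"
          using T(3) gT[OF jl(1)] gT[OF jl(2)] by blast
      qed
      show "contact_set u \<subseteq> (\<Union>j\<in>{1..card T}. closure (open_cube (fst (g j)) (snd (g j))))"
      proof
        fix y assume "y \<in> contact_set u"
        then obtain p where p: "p \<in> T" "y \<in> closure (open_cube (fst p) (snd p))" using cover by blast
        then obtain j where "j \<in> {1..card T}" "g j = p"
          using bij_betw_imp_surj_on[OF g] by (metis imageE)
        then show "y \<in> (\<Union>j\<in>{1..card T}. closure (open_cube (fst (g j)) (snd (g j))))"
          using p by blast
      qed
    qed (rule ballI, erule goodT[unfolded good_def])
  qed
qed

end
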